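(* Let $(X,\delta,\mu)\in\mathcal{N}(\widetilde\tau,c_1,c_2)$ and assume that continuous functions are dense in $L^1(X,\mu)$. Let $s>0$ and let $\mathcal{K}=\{K_\alpha:0<\alpha<1\}$ be a family of symmetric Markov kernels on $X$ such that \begin{enumerate} \item[(a)] $\mathcal{K}\subset\mathcal{H}_a(\gamma,H)$ for some $H\geq1$ and some $\gamma$ with $0<\gamma\leq(\tfrac{c_1}{2c_2})^2$; \item[(b)] there exists $R>0$ such that $K_\alpha\in\mathcal{S}(s,\alpha,R)$ for every $0<\alpha<1$. \end{enumerate} Then \begin{enumerate} \item[(i)] $\mathcal{K}$ concentrates: for every $\lambda>0$, $\int_{\delta(x,y)\geq\lambda}K_\alpha(x,y)\,d\mu(y)\to0$ as $\alpha\to0$, uniformly in $x\in X$; \item[(ii)] the maximal operator $\mathcal{K}^*f(x)=\sup_{0<\alpha<1}\left|\int_XK_\alpha(x,y)f(y)\,d\mu(y)\right|$ is of weak type $(1,1)$ and bounded on $L^p(X,\mu)$ for $1<p\leq\infty$; \item[(iii)] for every $f\in L^p(X,\mu)$, $1\leq p\leq\infty$, $\int_XK_\alpha(x,y)f(y)\,d\mu(y)\to f(x)$ as $\alpha\to0^+$ for $\mu$-almost every $x\in X$. \end{enumerate}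
   Context: $(X,\delta,\mu)\in\mathcal{N}(\widetilde\tau,c_1,c_2)$ means: $\delta$ is a quasi-distance on $X$ (nonnegative, symmetric, vanishing exactly on the diagonal, with $\delta(x,z)\leq\widetilde\tau[\delta(x,y)+\delta(y,z)]$), $\delta$-balls $B_\delta(x,r)=\{y:\delta(x,y)<r\}$ are open and measurable, $\mu$ is a positive measure with $\mu(\{x\})=0$ for all $x$, $\mu(X)=+\infty$, and $0<c_1<c_2<\infty$ satisfy $c_1r\leq\mu(B_\delta(x,r))\leq c_2r$ for all $x\in X$, $r>0$. A symmetric Markov kernel on $X$ is a nonnegative symmetric measurable $K$ on $X\times X$ with $\int_XK(x,y)\,d\mu(y)=1$ for every $x$. For $0<\gamma<1$, $H\geq1$, $K\in\mathcal{H}_a(\gamma,H)$ means $\sup_{y\in A(x,\gamma r,r)}K(x,y)\leq H\inf_{y\in A(x,\gamma r,r)}K(x,y)$ for every $x\in X$ and $r>0$, where $A(x,\gamma r,r)=B_\delta(x,r)\setminus B_\delta(x,\gamma r)$. For $s,\alpha,R>0$, $K\in\mathcal{S}(s,\alpha,R)$ means $K(x,y)\leq\alpha\,\delta(x,y)^{-(1+s)}$ for all $x,y\in X$ with $\delta(x,y)>R$. Weak type $(1,1)$: $\mu(\{x:|Tf(x)|>\lambda\})\leq C\lambda^{-1}\|f\|_{L^1(\mu)}$ for all $f$ and $\lambda>0$. *)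

theory Defs
  imports "HOL-Analysis.Analysis"
begin

definition quasi_distance :: "'a set \<Rightarrow> ('a \<Rightarrow> 'a \<Rightarrow> real) \<Rightarrow> real \<Rightarrow> bool" where
  "quasi_distance X \<delta> \<tau> \<longleftrightarrow>
     (\<forall>x\<in>X. \<forall>y\<in>X. \<delta> x y \<ge> 0 \<and> \<delta> x y = \<delta> y x \<and> (\<delta> x y = 0 \<longleftrightarrow> x = y)) \<and>
     (\<forall>x\<in>X. \<forall>y\<in>X. \<forall>z\<in>X. \<delta> x z \<le> \<tau> * (\<delta> x y + \<delta> y z))"

definition dball :: "'a set \<Rightarrow> ('a \<Rightarrow> 'a \<Rightarrow> real) \<Rightarrow> 'a \<Rightarrow> real \<Rightarrow> 'a set" where
  "dball X \<delta> x r = {y \<in> X. \<delta> x y < r}"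

definition delta_topology :: "'a set \<Rightarrow> ('a \<Rightarrow> 'a \<Rightarrow> real) \<Rightarrow> 'a topology" where
  "delta_topology X \<delta> = topology (\<lambda>U. U \<subseteq> X \<and> (\<forall>x\<in>U. \<exists>r>0. dball X \<delta> x r \<subseteq> U))"

definition in_class_N :: "'a measure \<Rightarrow> ('a \<Rightarrow> 'a \<Rightarrow> real) \<Rightarrow> real \<Rightarrow> real \<Rightarrow> real \<Rightarrow> bool" where
  "in_class_N M \<delta> \<tau> c1 c2 \<longleftrightarrow>
     quasi_distance (space M) \<delta> \<tau> \<and>
     (\<forall>x\<in>space M. \<forall>r>0. openin (delta_topology (space M) \<delta>) (dball (space M) \<delta> x r)
                          \<and> dball (space M) \<delta> x r \<in> sets M) \<and>
     (\<forall>x\<in>space M. emeasure M {x} = 0) \<and>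
     emeasure M (space M) = \<infinity> \<and>
     0 < c1 \<and> c1 < c2 \<and>
     (\<forall>x\<in>space M. \<forall>r>0. ennreal (c1 * r) \<le> emeasure M (dball (space M) \<delta> x r)
                          \<and> emeasure M (dball (space M) \<delta> x r) \<le> ennreal (c2 * r))"

definition symmetric_markov_kernel :: "'a measure \<Rightarrow> ('a \<Rightarrow> 'a \<Rightarrow> real) \<Rightarrow> bool" where
  "symmetric_markov_kernel M K \<longleftrightarrow>
     (\<lambda>(x, y). K x y) \<in> borel_measurable (M \<Otimes>\<^sub>M M) \<and>
     (\<forall>x\<in>space M. \<forall>y\<in>space M. 0 \<le> K x y \<and> K x y = K y x) \<and>
     (\<forall>x\<in>space M. (\<integral>\<^sup>+ y. ennreal (K x y) \<partial>M) = 1)"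

definition annulus :: "'a set \<Rightarrow> ('a \<Rightarrow> 'a \<Rightarrow> real) \<Rightarrow> 'a \<Rightarrow> real \<Rightarrow> real \<Rightarrow> 'a set" where
  "annulus X \<delta> x r1 r2 = dball X \<delta> x r2 - dball X \<delta> x r1"

text \<open>K in H_a(gamma, H): sup over the annulus is at most H times the inf over the annulus
  (written out pointwise).\<close>
definition class_Ha :: "'a measure \<Rightarrow> ('a \<Rightarrow> 'a \<Rightarrow> real) \<Rightarrow> real \<Rightarrow> real \<Rightarrow> ('a \<Rightarrow> 'a \<Rightarrow> real) \<Rightarrow> bool" where
  "class_Ha M \<delta> \<gamma> H K \<longleftrightarrow>
     (\<forall>x\<in>space M. \<forall>r>0. \<forall>y\<in>annulus (space M) \<delta> x (\<gamma> * r) r.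
        \<forall>z\<in>annulus (space M) \<delta> x (\<gamma> * r) r. K x y \<le> H * K x z)"

definition class_S :: "'a measure \<Rightarrow> ('a \<Rightarrow> 'a \<Rightarrow> real) \<Rightarrow> real \<Rightarrow> real \<Rightarrow> real \<Rightarrow> ('a \<Rightarrow> 'a \<Rightarrow> real) \<Rightarrow> bool" where
  "class_S M \<delta> s \<alpha> R K \<longleftrightarrow>
     (\<forall>x\<in>space M. \<forall>y\<in>space M. \<delta> x y > R \<longrightarrow> K x y \<le> \<alpha> * \<delta> x y powr (-(1 + s)))"

definition in_Lp :: "'a measure \<Rightarrow> real \<Rightarrow> ('a \<Rightarrow> real) \<Rightarrow> bool" where
  "in_Lp M p f \<longleftrightarrow> f \<in> borel_measurable M \<and> integrable M (\<lambda>x. \<bar>f x\<bar> powr p)"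

definition in_Linf :: "'a measure \<Rightarrow> ('a \<Rightarrow> real) \<Rightarrow> bool" where
  "in_Linf M f \<longleftrightarrow> f \<in> borel_measurable M \<and> (\<exists>B. AE x in M. \<bar>f x\<bar> \<le> B)"

definition continuous_dense_L1 :: "'a measure \<Rightarrow> ('a \<Rightarrow> 'a \<Rightarrow> real) \<Rightarrow> bool" where
  "continuous_dense_L1 M \<delta> \<longleftrightarrow>
     (\<forall>f. f \<in> borel_measurable M \<and> integrable M f \<longrightarrow>
        (\<forall>\<epsilon>>0. \<exists>g. continuous_map (delta_topology (space M) \<delta>) euclideanreal g \<and>
                     g \<in> borel_measurable M \<and> integrable M g \<and>
                     (\<integral>\<^sup>+ x. ennreal \<bar>f x - g x\<bar> \<partial>M) < ennreal \<epsilon>))"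

definition kernel_op :: "'a measure \<Rightarrow> ('a \<Rightarrow> 'a \<Rightarrow> real) \<Rightarrow> ('a \<Rightarrow> real) \<Rightarrow> 'a \<Rightarrow> real" where
  "kernel_op M K f x = (\<integral> y. K x y * f y \<partial>M)"

definition maximal_op :: "'a measure \<Rightarrow> (real \<Rightarrow> 'a \<Rightarrow> 'a \<Rightarrow> real) \<Rightarrow> ('a \<Rightarrow> real) \<Rightarrow> 'a \<Rightarrow> ennreal" where
  "maximal_op M K f x = (SUP \<alpha>\<in>{0<..<1}. ennreal \<bar>kernel_op M (K \<alpha>) f x\<bar>)"

end

theory Submission
  imports Defs
begin

text \<open>
  On each annulus of outer radius \<open>r\<close> around \<open>x\<close> the Harnack condition bounds a kernel by its
  average, so that \<open>\<integral> K(x, y) h(y) dy\<close> is a convex combination of means of \<open>h\<close> over balls around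
  \<open>x\<close>, up to a constant. Hence the maximal operator is dominated by the Hardy-Littlewood maximal
  function, which is of weak type (1,1) by a Vitali covering argument and bounded on \<open>L\<^sup>p\<close> by
  interpolation. Chaining the Harnack condition through overlapping annuli from the region
  \<open>\<delta> > R\<close> inwards gives \<open>K\<^sub>\<alpha>(x, y) \<le> \<alpha> C\<^sub>t \<delta>(x, y)\<^bsup>-(1+s)\<^esup>\<close> whenever \<open>\<delta>(x, y) \<ge> t\<close>, and therefore
  concentration. Almost everywhere convergence is clear for continuous integrable functions,
  extends to \<open>L\<^sup>1\<close> by the weak type bound and density, to bounded functions by localisation, and to
  \<open>L\<^sup>p\<close> by splitting a function into its large and small values.
\<close>

text \<open>The square in the bound on \<open>\<gamma>\<close> comes from the chaining, which moves
  inwards by the factor \<open>sqrt \<gamma>\<close>. Consecutive annuli share the region between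
  \<open>\<gamma> * q\<close> and \<open>sqrt \<gamma> * q\<close>, whose measure is at least
  \<open>c1 * sqrt \<gamma> * q - c2 * \<gamma> * q\<close>, and
  \<open>sqrt \<gamma> \<le> c1 / (2 * c2)\<close> keeps this above half of its first term. For
  fixed \<open>t\<close> the number of links is bounded independently of the point and of the
  kernel, so the Harnack factors stay bounded and the small factor \<alpha> survives.

  The decay yields two facts about the region at distance at least \<open>t\<close>: the mass of the
  kernel and its supremum are both O(\<alpha>). Mass alone is enough against bounded functions, but
  the continuous functions supplied by density are only integrable, and for them the supremum is
  needed as well.

  Measurability shapes the rest. The supremum runs over uncountably many parameters, so estimates go
  through a measurable majorant, and the exceptional null sets come from countable families.\<close>

section \<open>Balls in an Ahlfors regular quasi-metric space\<close>

locale ahlfors_space =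
  fixes M :: "'a measure" and \<delta> :: "'a \<Rightarrow> 'a \<Rightarrow> real" and \<tau> c1 c2 :: real
  assumes tau_ge_1: "1 \<le> \<tau>"
    and c1_pos: "0 < c1" and c1_less_c2: "c1 < c2"
    and nonneg: "\<And>x y. x \<in> space M \<Longrightarrow> y \<in> space M \<Longrightarrow> 0 \<le> \<delta> x y"
    and sym: "\<And>x y. x \<in> space M \<Longrightarrow> y \<in> space M \<Longrightarrow> \<delta> x y = \<delta> y x"
    and zero_iff: "\<And>x y. x \<in> space M \<Longrightarrow> y \<in> space M \<Longrightarrow> \<delta> x y = 0 \<longleftrightarrow> x = y"
    and triangle: "\<And>x y z. x \<in> space M \<Longrightarrow> y \<in> space M \<Longrightarrow> z \<in> space M
                     \<Longrightarrow> \<delta> x z \<le> \<tau> * (\<delta> x y + \<delta> y z)"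
    and pos_ball_sets: "\<And>x r. x \<in> space M \<Longrightarrow> 0 < r \<Longrightarrow> dball (space M) \<delta> x r \<in> sets M"
    and singleton_null: "\<And>x. x \<in> space M \<Longrightarrow> emeasure M {x} = 0"
    and space_infinite: "emeasure M (space M) = \<infinity>"
    and ball_ge: "\<And>x r. x \<in> space M \<Longrightarrow> 0 < r \<Longrightarrow> ennreal (c1 * r) \<le> emeasure M (dball (space M) \<delta> x r)"
    and ball_le: "\<And>x r. x \<in> space M \<Longrightarrow> 0 < r \<Longrightarrow> emeasure M (dball (space M) \<delta> x r) \<le> ennreal (c2 * r)"
begin

abbreviation B :: "'a \<Rightarrow> real \<Rightarrow> 'a set" where
  "B \<equiv> dball (space M) \<delta>"

lemma B_subset_space: "B x r \<subseteq> space M"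
  by (auto simp: dball_def)

lemma mem_B_iff: "y \<in> B x r \<longleftrightarrow> y \<in> space M \<and> \<delta> x y < r"
  by (auto simp: dball_def)

lemma c2_pos: "0 < c2"
  using c1_pos c1_less_c2 by simp

lemma tau_pos: "0 < \<tau>"
  using tau_ge_1 by simp

lemma B_sets [measurable]: "x \<in> space M \<Longrightarrow> B x r \<in> sets M"
proof (cases "0 < r")
  case False
  assume "x \<in> space M"
  then have "B x r = {}"
    using False nonneg by (force simp: dball_def)
  then show ?thesis by simp
qed (rule pos_ball_sets)

lemma emeasure_B_finite: "x \<in> space M \<Longrightarrow> emeasure M (B x r) < \<infinity>"
proof -
  assume x: "x \<in> space M"
  have "emeasure M (B x r) \<le> emeasure M (B x (max r 1))"
    using x by (intro emeasure_mono B_sets) (auto simp: mem_B_iff)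
  also have "\<dots> \<le> ennreal (c2 * max r 1)"
    using x by (intro ball_le) auto
  also have "\<dots> < \<infinity>" by simp
  finally show ?thesis .
qed

lemma B_dilate:
  assumes "x \<in> space M" "y \<in> B x r" "z \<in> B y q"
  shows "z \<in> B x (\<tau> * (r + q))"
proof -
  have "\<delta> x z \<le> \<tau> * (\<delta> x y + \<delta> y z)"
    using assms by (intro triangle) (auto simp: dball_def)
  also have "\<dots> < \<tau> * (r + q)"
    using assms tau_pos by (intro mult_strict_left_mono) (auto simp: dball_def)
  finally show ?thesis
    using assms by (auto simp: dball_def)
qed

lemma mem_B_sym: "x \<in> space M \<Longrightarrow> y \<in> B x r \<Longrightarrow> x \<in> B y r"
  by (auto simp: dball_def sym)

lemma space_eq_UN_B:
  assumes "x \<in> space M"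
  shows "space M = (\<Union>n::nat. B x (real n))"
  using reals_Archimedean2 by (auto simp: dball_def)

lemma space_nonempty: "space M \<noteq> {}"
  using space_infinite by auto

text \<open>Since \<open>emeasure\<close> is 0 on nonmeasurable sets by convention,
  \<open>singleton_null\<close> becomes useful only once the singleton is known to be measurable; it
  is a countable intersection of balls. The centre has to be discarded because the annuli around it
  never reach it.\<close>

lemma AE_neq: "x \<in> space M \<Longrightarrow> AE y in M. y \<noteq> x"
proof -
  assume x: "x \<in> space M"
  have "{x} = (\<Inter>n::nat. B x (1 / real (Suc n)))"
  proof
    show "{x} \<subseteq> (\<Inter>n::nat. B x (1 / real (Suc n)))"
      using x zero_iff[of x x] by (auto simp: dball_def)
    show "(\<Inter>n::nat. B x (1 / real (Suc n))) \<subseteq> {x}"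
    proof
      fix y assume y: "y \<in> (\<Inter>n::nat. B x (1 / real (Suc n)))"
      then have ys: "y \<in> space M" by (auto simp: dball_def)
      have "\<not> 0 < \<delta> x y"
      proof
        assume "0 < \<delta> x y"
        then obtain n where "inverse (real (Suc n)) < \<delta> x y"
          using reals_Archimedean by blast
        moreover have "y \<in> B x (1 / real (Suc n))" using y by blast
        ultimately show False
          by (simp add: dball_def inverse_eq_divide)
      qed
      then have "\<delta> x y = 0"
        using nonneg[OF x ys] by simp
      then show "y \<in> {x}"
        using zero_iff x ys by auto
    qed
  qed
  moreover have "(\<Inter>n::nat. B x (1 / real (Suc n))) \<in> sets M"
    using x by (intro sets.countable_INT) auto
  ultimately have "{x} \<in> sets M"
    by metis
  then have "{x} \<in> null_sets M"
    using singleton_null x by blast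
  then show ?thesis
    by (intro AE_I'[of "{x}"]) auto
qed

section \<open>Separability by counting volumes\<close>

text \<open>Small balls around separated points are disjoint and lie in one large ball, so the
  two-sided measure bounds limit their number.\<close>

lemma separated_card_bound:
  assumes "x \<in> space M" "0 < m" "0 < e"
  shows "\<exists>N. \<forall>F. finite F \<and> F \<subseteq> B x m \<and> pairwise (\<lambda>a b. e \<le> \<delta> a b) F \<longrightarrow> card F \<le> N"
proof -
  \<comment> \<open>If two balls of radius \<open>q\<close> meet, their centres are closer than
    \<open>\<tau> * (q + q)\<close>, so this \<open>q\<close> turns \<open>e\<close>-separation into
    disjointness. \<open>V\<close> below is the upper bound for the enclosing ball divided by the
    lower bound for a small one.\<close>
  define q where "q = e / (2 * \<tau>)"
  have q: "0 < q" "\<tau> * (q + q) = e"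
    using assms tau_pos by (auto simp: q_def field_simps)
  define V where "V = c2 * (\<tau> * (m + q)) / (c1 * q)"
  have "card F \<le> nat \<lceil>V\<rceil>"
    if F: "finite F" "F \<subseteq> B x m" "pairwise (\<lambda>a b. e \<le> \<delta> a b) F" for F
  proof -
    have Fs: "F \<subseteq> space M" using F(2) B_subset_space by blast
    have disj: "disjoint_family_on (\<lambda>a. B a q) F"
      unfolding disjoint_family_on_def
    proof (intro ballI impI)
      fix a b assume ab: "a \<in> F" "b \<in> F" "a \<noteq> b"
      show "B a q \<inter> B b q = {}"
      proof (rule ccontr)
        assume "B a q \<inter> B b q \<noteq> {}"
        then obtain w where w: "w \<in> B a q" "w \<in> B b q" by blast
        have "b \<in> B a (\<tau> * (q + q))"
          using w ab Fs by (intro B_dilate[of _ w]) (auto intro: mem_B_sym)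
        then show False
          using ab F(3) unfolding q(2) by (force simp: pairwise_def dball_def)
      qed
    qed
    have "ennreal (real (card F) * (c1 * q)) = (\<Sum>a\<in>F. ennreal (c1 * q))"
      using c1_pos q by (simp add: ennreal_mult ennreal_of_nat_eq_real_of_nat)
    also have "\<dots> \<le> (\<Sum>a\<in>F. emeasure M (B a q))"
      using Fs q by (intro sum_mono ball_ge) auto
    also have "\<dots> = emeasure M (\<Union>a\<in>F. B a q)"
      using F(1) Fs disj by (intro sum_emeasure) auto
    also have "\<dots> \<le> emeasure M (B x (\<tau> * (m + q)))"
      using F(2) assms B_dilate by (intro emeasure_mono) auto
    also have "\<dots> \<le> ennreal (c2 * (\<tau> * (m + q)))"
      using assms q tau_pos by (intro ball_le) auto
    finally have "real (card F) * (c1 * q) \<le> c2 * (\<tau> * (m + q))"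
      using c2_pos tau_pos assms q by (simp add: ennreal_le_iff)
    then have "real (card F) \<le> V"
      using c1_pos q by (simp add: V_def pos_le_divide_eq)
    then show ?thesis by linarith
  qed
  then show ?thesis by blast
qed

text \<open>A separated set of largest cardinality is a net: a point far from all its members could
  be added to it.\<close>

lemma finite_net:
  assumes "x \<in> space M" "0 < m" "0 < e"
  shows "\<exists>F. finite F \<and> F \<subseteq> space M \<and> (\<forall>y\<in>B x m. \<exists>a\<in>F. \<delta> a y < e)"
proof -
  let ?P = "\<lambda>F. finite F \<and> F \<subseteq> B x m \<and> pairwise (\<lambda>a b. e \<le> \<delta> a b) F"
  obtain N where N: "\<And>F. ?P F \<Longrightarrow> card F \<le> N"
    using separated_card_bound[OF assms] by blast
  have "\<exists>F. ?P F \<and> (\<forall>G. ?P G \<longrightarrow> card G \<le> card F)"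
    by (rule ex_has_greatest_nat[where k = "{}" and b = "Suc N"]) (use N in \<open>auto simp: less_Suc_eq_le\<close>)
  then obtain F where F: "?P F" and max: "\<And>G. ?P G \<Longrightarrow> card G \<le> card F"
    by blast
  have "\<exists>a\<in>F. \<delta> a y < e" if y: "y \<in> B x m" for y
  proof (rule ccontr)
    assume "\<not> (\<exists>a\<in>F. \<delta> a y < e)"
    then have far: "\<And>a. a \<in> F \<Longrightarrow> e \<le> \<delta> a y" by force
    have ys: "y \<in> space M" using y B_subset_space by blast
    have "y \<notin> F"
      using far[of y] zero_iff[of y y] ys assms(3) by auto
    moreover have "?P (insert y F)"
      using F y far sym[OF ys] B_subset_space by (fastforce simp: pairwise_insert)
    ultimately show False
      using max[of "insert y F"] F by simp
  qed
  then show ?thesis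
    using F B_subset_space[of x m] by (intro exI[of _ F]) auto
qed

lemma ex_countable_dense:
  "\<exists>D. countable D \<and> D \<subseteq> space M \<and> (\<forall>x\<in>space M. \<forall>e>0. \<exists>d\<in>D. \<delta> d x < e)"
proof -
  obtain x where x: "x \<in> space M"
    using space_nonempty by blast
  obtain F where F: "\<And>m n::nat. finite (F m n) \<and> F m n \<subseteq> space M \<and>
      (\<forall>y\<in>B x (real (Suc m)). \<exists>a\<in>F m n. \<delta> a y < 1 / real (Suc n))"
    using finite_net[OF x, of "real (Suc m)" "1 / real (Suc n)" for m n] by (simp del: of_nat_Suc) metis
  let ?D = "\<Union>m n. F m n"
  have "\<exists>d\<in>?D. \<delta> d y < e" if y: "y \<in> space M" "0 < e" for y e
  proof -
    obtain n where n: "inverse (real (Suc n)) < e"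
      using reals_Archimedean y(2) by blast
    obtain m where "\<delta> x y < real m"
      using reals_Archimedean2 by blast
    then have "y \<in> B x (real (Suc m))"
      using y by (simp add: dball_def)
    then obtain a where "a \<in> F m n" "\<delta> a y < 1 / real (Suc n)"
      using F by blast
    then show ?thesis
      using n by (intro bexI[of _ a]) (auto simp: inverse_eq_divide)
  qed
  moreover have "countable ?D"
    using F by (intro countable_UN) (auto intro: countable_finite)
  moreover have "?D \<subseteq> space M"
    using F by blast
  ultimately show ?thesis
    by (intro exI[of _ ?D] conjI ballI allI impI)
qed

definition D :: "'a set" where
  "D = (SOME D. countable D \<and> D \<subseteq> space M \<and> (\<forall>x\<in>space M. \<forall>e>0. \<exists>d\<in>D. \<delta> d x < e))"

lemma countable_D: "countable D"
  and D_subset: "D \<subseteq> space M"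
  and D_dense: "x \<in> space M \<Longrightarrow> 0 < e \<Longrightarrow> \<exists>d\<in>D. \<delta> d x < e"
  using someI_ex[OF ex_countable_dense] unfolding D_def by blast+

section \<open>The Hardy-Littlewood maximal function\<close>

text \<open>Restricting the uncentred maximal function to countably many balls makes it measurable and
  costs only a constant factor.\<close>

definition idx :: "('a \<times> real) set" where
  "idx = D \<times> (\<rat> \<inter> {0<..})"

definition hlmax :: "('a \<Rightarrow> ennreal) \<Rightarrow> 'a \<Rightarrow> ennreal" where
  "hlmax h x = (SUP i\<in>idx. (\<integral>\<^sup>+ y\<in>B (fst i) (snd i). h y \<partial>M) / ennreal (snd i) * indicator (B (fst i) (snd i)) x)"

lemma countable_idx: "countable idx"
  using countable_D countable_rat by (auto simp: idx_def intro!: countable_SIGMA)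

lemma idxD: "i \<in> idx \<Longrightarrow> fst i \<in> space M \<and> 0 < snd i"
  using D_subset by (auto simp: idx_def)

lemma hlmax_measurable [measurable]: "hlmax h \<in> borel_measurable M"
  unfolding hlmax_def[abs_def]
  by (intro borel_measurable_SUP countable_idx borel_measurable_times_ennreal
      borel_measurable_const borel_measurable_indicator B_sets) (simp add: idxD)

text \<open>\<open>hlmax\<close> divides by the radius, which Ahlfors regularity makes comparable to
  the measure of the ball. Moving the centre to a dense point and the radius to a rational number
  therefore costs only the ratio of the two radii.\<close>

lemma nn_integral_B_le_hlmax:
  assumes "x \<in> space M" "0 < r"
  shows "(\<integral>\<^sup>+ y\<in>B x r. h y \<partial>M) \<le> ennreal (3 * \<tau> * r) * hlmax h x"
proof -
  obtain d where d: "d \<in> D" "\<delta> d x < r"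
    using D_dense assms by blast
  then have ds: "d \<in> space M" using D_subset by blast
  \<comment> \<open>A ball about \<open>d\<close> of radius \<open>\<tau> * (r + r)\<close> already
    contains \<open>B x r\<close>; the gap up to \<open>3 * \<tau> * r\<close> leaves room for a
    rational radius.\<close>
  have "2 * \<tau> * r < 3 * \<tau> * r"
    using assms tau_pos by simp
  then obtain q where q: "q \<in> \<rat>" "2 * \<tau> * r < q" "q < 3 * \<tau> * r"
    using Rats_dense_in_real by blast
  have "r * 1 \<le> r * \<tau>"
    using tau_ge_1 assms by (intro mult_left_mono) auto
  then have "r \<le> \<tau> * r" "0 < \<tau> * r"
    using assms tau_pos by (simp_all add: mult.commute)
  then have rq: "r \<le> q" using q by linarith
  then have q0: "0 < q" using assms by simp
  have xd: "x \<in> B d r" using assms d by (simp add: dball_def)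
  have i: "(d, q) \<in> idx" using d q q0 by (simp add: idx_def)
  have sub: "B x r \<subseteq> B d q"
    using B_dilate[OF ds xd] q(2) by (fastforce simp: dball_def algebra_simps)
  have "(\<integral>\<^sup>+ y\<in>B x r. h y \<partial>M) \<le> (\<integral>\<^sup>+ y\<in>B d q. h y \<partial>M)"
    using sub by (intro nn_integral_mono mult_left_mono) (auto simp: indicator_def)
  also have "\<dots> = ennreal q * ((\<integral>\<^sup>+ y\<in>B d q. h y \<partial>M) / ennreal q * indicator (B d q) x)"
    using q0 xd rq by (simp add: mem_B_iff ennreal_times_divide mult_divide_eq_ennreal mult.commute[of "ennreal q"])
  also have "\<dots> \<le> ennreal q * hlmax h x"
    unfolding hlmax_def using i by (intro mult_left_mono SUP_upper2[of "(d, q)"]) auto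
  also have "\<dots> \<le> ennreal (3 * \<tau> * r) * hlmax h x"
    using q by (intro mult_right_mono ennreal_leI) auto
  finally show ?thesis .
qed

text \<open>A constant \<open>b\<close> contributes \<open>b\<close> times measure over radius, at
  most \<open>c2 * b\<close>. This allows a function to be altered by a bounded amount, both in the
  truncation behind the interpolation and in passing from \<open>L^p\<close> to
  \<open>L^1\<close>.\<close>

lemma hlmax_le_add_const:
  assumes [measurable]: "h \<in> borel_measurable M"
    and "0 \<le> b" "\<And>y. y \<in> space M \<Longrightarrow> k y \<le> h y + ennreal b"
  shows "hlmax k x \<le> hlmax h x + ennreal (c2 * b)"
  unfolding hlmax_def[of k]
proof (rule SUP_least)
  fix i assume i: "i \<in> idx"
  define d q where "d = fst i" and "q = snd i"
  have d: "d \<in> space M" and q: "0 < q" using idxD[OF i] by (auto simp: d_def q_def)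
  note [measurable] = B_sets[OF d, of q]
  have "(\<integral>\<^sup>+ y\<in>B d q. k y \<partial>M) \<le> (\<integral>\<^sup>+ y. h y * indicator (B d q) y + ennreal b * indicator (B d q) y \<partial>M)"
    using assms by (intro nn_integral_mono) (auto simp: indicator_def)
  also have "\<dots> = (\<integral>\<^sup>+ y\<in>B d q. h y \<partial>M) + ennreal b * emeasure M (B d q)"
    by (subst nn_integral_add) (auto simp: nn_integral_cmult)
  also have "\<dots> \<le> (\<integral>\<^sup>+ y\<in>B d q. h y \<partial>M) + ennreal b * ennreal (c2 * q)"
    using ball_le[OF d q] by (intro add_left_mono mult_left_mono) auto
  finally have "(\<integral>\<^sup>+ y\<in>B d q. k y \<partial>M) / ennreal q
      \<le> ((\<integral>\<^sup>+ y\<in>B d q. h y \<partial>M) + ennreal b * ennreal (c2 * q)) / ennreal q"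
    by (rule divide_right_mono_ennreal)
  also have "\<dots> = (\<integral>\<^sup>+ y\<in>B d q. h y \<partial>M) / ennreal q + ennreal (c2 * b)"
    using q assms(2) c2_pos
    by (simp add: add_divide_distrib_ennreal ennreal_mult[symmetric] divide_ennreal mult.commute)
  finally have le: "(\<integral>\<^sup>+ y\<in>B d q. k y \<partial>M) / ennreal q \<le> \<dots>" .
  show "(\<integral>\<^sup>+ y\<in>B (fst i) (snd i). k y \<partial>M) / ennreal (snd i) * indicator (B (fst i) (snd i)) x
     \<le> hlmax h x + ennreal (c2 * b)"
  proof (cases "x \<in> B d q")
    case True
    have "(\<integral>\<^sup>+ y\<in>B d q. h y \<partial>M) / ennreal q \<le> hlmax h x"
      unfolding hlmax_def using i True by (intro SUP_upper2[of i]) (auto simp: d_def q_def)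
    then have "(\<integral>\<^sup>+ y\<in>B d q. k y \<partial>M) / ennreal q \<le> hlmax h x + ennreal (c2 * b)"
      using le by (meson add_right_mono order_trans)
    then show ?thesis
      using True by (simp add: d_def q_def)
  qed (simp add: d_def q_def)
qed

end

section \<open>Vitali covering and the weak type (1,1) bound\<close>

lemma ennreal_eq_0_if_le_harmonic:
  assumes "I < (\<infinity>::ennreal)" "\<And>n::nat. x \<le> ennreal (C / real (Suc n)) * I"
  shows "x = 0"
proof -
  have "(\<lambda>n. ennreal (C / real (Suc n))) \<longlonglongrightarrow> ennreal 0"
    by (intro tendsto_ennrealI LIMSEQ_Suc[OF lim_const_over_n])
  then have "(\<lambda>n. I * ennreal (C / real (Suc n))) \<longlonglongrightarrow> I * ennreal 0"
    using assms(1) by (intro ennreal_tendsto_cmult) auto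
  then have "x \<le> 0"
    using assms(2) by (intro LIMSEQ_le_const[of _ 0]) (auto simp: mult.commute)
  then show ?thesis by simp
qed

context ahlfors_space
begin

abbreviation Bi :: "'a \<times> real \<Rightarrow> 'a set" where
  "Bi i \<equiv> B (fst i) (snd i)"

text \<open>The quasi-metric form of the classical dilation factor 3, which is its value at
  \<open>\<tau> = 1\<close>: two applications of the quasi-triangle inequality bring a ball of
  radius at most \<open>r\<close> that meets \<open>B e r\<close> inside the dilate of
  \<open>B e r\<close>.\<close>

definition vitali :: real where
  "vitali = \<tau> * (1 + \<tau> * 2)"

lemma vitali_pos: "0 < vitali"
  using tau_pos by (auto simp: vitali_def intro!: mult_pos_pos add_pos_pos)

lemma B_subset_dilate:
  assumes "d \<in> space M" "e \<in> space M" "q \<le> r" "B d q \<inter> B e r \<noteq> {}"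
  shows "B d q \<subseteq> B e (vitali * r)"
proof
  fix y assume y: "y \<in> B d q"
  obtain w where w: "w \<in> B d q" "w \<in> B e r" using assms(4) by auto
  have "d \<in> B w q" using w assms by (simp add: mem_B_sym)
  then have "y \<in> B w (\<tau> * (q + q))"
    using w y B_subset_space by (intro B_dilate) auto
  then have "y \<in> B e (\<tau> * (r + \<tau> * (q + q)))"
    using w assms by (intro B_dilate[of e w]) auto
  moreover have "\<tau> * (r + \<tau> * (q + q)) \<le> \<tau> * (r + \<tau> * (r + r))"
    using assms tau_pos by (intro mult_left_mono add_left_mono add_mono) auto
  moreover have "\<tau> * (r + \<tau> * (r + r)) = vitali * r"
    by (simp add: vitali_def algebra_simps)
  ultimately show "y \<in> B e (vitali * r)"
    by (auto simp: mem_B_iff)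
qed

text \<open>Greedy selection: keep a ball of largest radius, discard all balls that meet it, and
  repeat with the rest. A discarded ball is no larger than the selected ball it meets, hence lies in
  the dilate of that ball.\<close>

lemma vitali_finite:
  assumes "finite S" "\<And>i. i \<in> S \<Longrightarrow> fst i \<in> space M \<and> 0 < snd i"
  shows "\<exists>T\<subseteq>S. disjoint_family_on Bi T \<and> (\<Union>i\<in>S. Bi i) \<subseteq> (\<Union>i\<in>T. B (fst i) (vitali * snd i))"
  using assms
proof (induction S rule: finite_psubset_induct)
  case (psubset S)
  show ?case
  proof (cases "S = {}")
    case False
    have "\<exists>m\<in>S. \<forall>i\<in>S. snd i \<le> snd m"
      using Max_in[of "snd ` S"] Max_ge[of "snd ` S"] psubset(1) False by fastforce
    then obtain m where m: "m \<in> S" "\<And>i. i \<in> S \<Longrightarrow> snd i \<le> snd m" by blast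
    define S' where "S' = {i\<in>S. Bi i \<inter> Bi m = {}}"
    \<comment> \<open>The selected ball is nonempty, so it meets itself and drops out of
      \<open>S'\<close>; this makes the induction decrease strictly.\<close>
    have "fst m \<in> Bi m"
      using psubset.prems[OF m(1)] zero_iff[of "fst m" "fst m"] by (simp add: mem_B_iff)
    then have "m \<notin> S'" by (auto simp: S'_def)
    then have "S' \<subset> S" using m by (auto simp: S'_def)
    then obtain T where T: "T \<subseteq> S'" "disjoint_family_on Bi T"
      "(\<Union>i\<in>S'. Bi i) \<subseteq> (\<Union>i\<in>T. B (fst i) (vitali * snd i))"
      using psubset.IH[of S'] psubset.prems by (auto simp: S'_def)
    have "disjoint_family_on Bi (insert m T)"
      using T(1,2) by (auto simp: disjoint_family_on_def S'_def)
    moreover have "Bi i \<subseteq> (\<Union>i\<in>insert m T. B (fst i) (vitali * snd i))" if "i \<in> S" for i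
    proof (cases "i \<in> S'")
      case True
      then show ?thesis using T(3) by blast
    next
      case False
      then have "Bi i \<inter> Bi m \<noteq> {}" using that by (auto simp: S'_def)
      then have "Bi i \<subseteq> B (fst m) (vitali * snd m)"
        using m that psubset.prems by (intro B_subset_dilate) auto
      then show ?thesis by blast
    qed
    moreover have "insert m T \<subseteq> S"
      using m T \<open>S' \<subset> S\<close> by blast
    ultimately show ?thesis
      by (intro exI[of _ "insert m T"]) blast
  qed (auto simp: disjoint_family_on_def)
qed

text \<open>The union is covered by the dilates of disjoint balls, whose measures are proportional
  to the radii. Each radius is at most \<open>1 / t\<close> times the integral of \<open>h\<close>
  over its ball, and by disjointness these integrals add up to at most the whole.\<close>

lemma emeasure_heavy_balls_finite:
  assumes [measurable]: "h \<in> borel_measurable M" and t: "0 < t"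
    and S: "finite S" "\<And>i. i \<in> S \<Longrightarrow> fst i \<in> space M \<and> 0 < snd i"
    and heavy: "\<And>i. i \<in> S \<Longrightarrow> ennreal (t * snd i) \<le> (\<integral>\<^sup>+ y\<in>Bi i. h y \<partial>M)"
  shows "emeasure M (\<Union>i\<in>S. Bi i) \<le> ennreal (c2 * vitali / t) * (\<integral>\<^sup>+ y. h y \<partial>M)"
proof -
  obtain T where T: "T \<subseteq> S" "disjoint_family_on Bi T"
      "(\<Union>i\<in>S. Bi i) \<subseteq> (\<Union>i\<in>T. B (fst i) (vitali * snd i))"
    using vitali_finite[OF S] by blast
  have fT: "finite T" using T S finite_subset by blast
  have TS: "\<And>i. i \<in> T \<Longrightarrow> fst i \<in> space M \<and> 0 < snd i" using T S by blast
  have "emeasure M (\<Union>i\<in>S. Bi i) \<le> emeasure M (\<Union>i\<in>T. B (fst i) (vitali * snd i))"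
    using T fT TS by (intro emeasure_mono sets.finite_UN B_sets) auto
  also have "\<dots> \<le> (\<Sum>i\<in>T. emeasure M (B (fst i) (vitali * snd i)))"
    using fT TS by (intro emeasure_subadditive_finite) auto
  also have "\<dots> \<le> (\<Sum>i\<in>T. ennreal (c2 * (vitali * snd i)))"
    using TS vitali_pos by (intro sum_mono ball_le) auto
  also have "\<dots> = (\<Sum>i\<in>T. ennreal (c2 * vitali / t) * ennreal (t * snd i))"
    using TS vitali_pos c2_pos t by (intro sum.cong refl) (simp add: ennreal_mult[symmetric] less_imp_le)
  also have "\<dots> \<le> (\<Sum>i\<in>T. ennreal (c2 * vitali / t) * (\<integral>\<^sup>+ y\<in>Bi i. h y \<partial>M))"
    using heavy T by (intro sum_mono mult_left_mono) auto
  also have "\<dots> = ennreal (c2 * vitali / t) * (\<integral>\<^sup>+ y. (\<Sum>i\<in>T. h y * indicator (Bi i) y) \<partial>M)"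
    using TS by (subst nn_integral_sum) (auto simp: sum_distrib_left)
  also have "\<dots> = ennreal (c2 * vitali / t) * (\<integral>\<^sup>+ y. h y * indicator (\<Union>i\<in>T. Bi i) y \<partial>M)"
    by (simp add: indicator_UN_disjoint[OF fT T(2)] sum_distrib_left)
  also have "\<dots> \<le> ennreal (c2 * vitali / t) * (\<integral>\<^sup>+ y. h y \<partial>M)"
    by (intro mult_left_mono nn_integral_mono) (auto simp: indicator_def)
  finally show ?thesis .
qed

text \<open>The superlevel set is covered by the countable family of heavy balls. Exhausting that
  family by finite subfamilies and using continuity of the measure from below avoids any a priori
  bound on the radii in the covering argument.\<close>

lemma hlmax_weak_type:
  assumes [measurable]: "h \<in> borel_measurable M" and t: "0 < t"
  shows "emeasure M {x \<in> space M. ennreal t < hlmax h x} \<le> ennreal (c2 * vitali / t) * (\<integral>\<^sup>+ y. h y \<partial>M)"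
proof -
  define S where "S = {i \<in> idx. ennreal (t * snd i) \<le> (\<integral>\<^sup>+ y\<in>Bi i. h y \<partial>M)}"
  have SM: "\<And>i. i \<in> S \<Longrightarrow> fst i \<in> space M \<and> 0 < snd i"
    using idxD by (auto simp: S_def)
  have cS: "countable S" using countable_idx by (auto simp: S_def)
  have sub: "{x \<in> space M. ennreal t < hlmax h x} \<subseteq> (\<Union>i\<in>S. Bi i)"
  proof
    fix x assume "x \<in> {x \<in> space M. ennreal t < hlmax h x}"
    then obtain i where i: "i \<in> idx"
      "ennreal t < (\<integral>\<^sup>+ y\<in>Bi i. h y \<partial>M) / ennreal (snd i) * indicator (Bi i) x"
      by (auto simp: hlmax_def less_SUP_iff)
    then have x: "x \<in> Bi i" and less: "ennreal t < (\<integral>\<^sup>+ y\<in>Bi i. h y \<partial>M) / ennreal (snd i)"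
      by (auto split: split_indicator_asm)
    have q: "0 < snd i" using idxD[OF i(1)] by simp
    have "ennreal (t * snd i) \<le> (\<integral>\<^sup>+ y\<in>Bi i. h y \<partial>M)"
    proof (rule ccontr)
      assume "\<not> ennreal (t * snd i) \<le> (\<integral>\<^sup>+ y\<in>Bi i. h y \<partial>M)"
      then have "(\<integral>\<^sup>+ y\<in>Bi i. h y \<partial>M) / ennreal (snd i) \<le> ennreal (t * snd i) / ennreal (snd i)"
        by (intro divide_right_mono_ennreal) auto
      also have "\<dots> = ennreal t"
        using q t by (simp add: divide_ennreal)
      finally show False using less by simp
    qed
    then show "x \<in> (\<Union>i\<in>S. Bi i)"
      using i(1) x by (intro UN_I[of i]) (auto simp: S_def)
  qed
  have "emeasure M (\<Union>i\<in>S. Bi i) \<le> ennreal (c2 * vitali / t) * (\<integral>\<^sup>+ y. h y \<partial>M)"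
  proof (cases "S = {}")
    case False
    define e where "e = from_nat_into S"
    have e: "range e = S"
      using False cS by (simp add: e_def range_from_nat_into)
    define U where "U n = (\<Union>i\<in>e ` {..<n}. Bi i)" for n
    have "U n \<in> sets M" for n
      unfolding U_def using e SM by (intro sets.finite_UN B_sets) auto
    then have "emeasure M (\<Union>n. U n) = (SUP n. emeasure M (U n))"
      by (intro SUP_emeasure_incseq[symmetric]) (force simp: incseq_def U_def)+
    also have "\<dots> \<le> ennreal (c2 * vitali / t) * (\<integral>\<^sup>+ y. h y \<partial>M)"
    proof (rule SUP_least)
      fix n
      have "e ` {..<n} \<subseteq> S" using e by auto
      then show "emeasure M (U n) \<le> ennreal (c2 * vitali / t) * (\<integral>\<^sup>+ y. h y \<partial>M)"
        unfolding U_def using SM t by (intro emeasure_heavy_balls_finite) (auto simp: S_def)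
    qed
    also have "(\<Union>n. U n) = (\<Union>i\<in>S. Bi i)"
      unfolding e[symmetric] U_def by auto
    finally show ?thesis .
  qed simp
  moreover have "emeasure M {x \<in> space M. ennreal t < hlmax h x} \<le> emeasure M (\<Union>i\<in>S. Bi i)"
    using sub cS SM by (intro emeasure_mono sets.countable_UN' B_sets) auto
  ultimately show ?thesis by (rule order_trans[rotated])
qed

lemma hlmax_finite_AE:
  assumes [measurable]: "h \<in> borel_measurable M" and fin: "(\<integral>\<^sup>+ y. h y \<partial>M) < \<infinity>"
  shows "AE x in M. hlmax h x < \<infinity>"
proof -
  have "emeasure M {x \<in> space M. hlmax h x = \<infinity>} = 0"
  proof (rule ennreal_eq_0_if_le_harmonic[OF fin])
    fix n :: nat
    have "emeasure M {x \<in> space M. hlmax h x = \<infinity>} \<le> emeasure M {x \<in> space M. ennreal (real (Suc n)) < hlmax h x}"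
      by (intro emeasure_mono) (auto simp del: of_nat_Suc)
    also have "\<dots> \<le> ennreal (c2 * vitali / real (Suc n)) * (\<integral>\<^sup>+ y. h y \<partial>M)"
      by (intro hlmax_weak_type) auto
    finally show "emeasure M {x \<in> space M. hlmax h x = \<infinity>} \<le> \<dots>" .
  qed
  then have "AE x in M. hlmax h x \<noteq> \<infinity>"
    by (subst AE_iff_measurable[OF _ refl]) auto
  then show ?thesis
    by eventually_elim (simp add: less_top)
qed

section \<open>Annuli, and domination of Harnack kernels by the maximal function\<close>

text \<open>Lower bound for the outer ball minus upper bound for the inner one. Should the
  difference be negative, \<open>ennreal\<close> truncates it to 0 and the claim is empty.\<close>

lemma emeasure_annulus_ge:
  assumes x: "x \<in> space M" and uv: "0 < u" "u \<le> v"
  shows "ennreal (c1 * v - c2 * u) \<le> emeasure M (annulus (space M) \<delta> x u v)"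
proof -
  have "ennreal (c1 * v - c2 * u) = ennreal (c1 * v) - ennreal (c2 * u)"
    using uv c2_pos by (subst ennreal_minus) auto
  also have "\<dots> \<le> emeasure M (B x v) - emeasure M (B x u)"
    using x uv by (intro ennreal_minus_mono ball_ge ball_le) auto
  also have "\<dots> = emeasure M (annulus (space M) \<delta> x u v)"
    unfolding annulus_def using x uv emeasure_B_finite[of x u]
    by (subst emeasure_Diff) (auto simp: mem_B_iff)
  finally show ?thesis .
qed

end

locale harnack_space = ahlfors_space +
  fixes \<gamma> H :: real
  assumes gamma_pos: "0 < \<gamma>" and gamma_le: "\<gamma> \<le> (c1 / (2 * c2))\<^sup>2" and H_ge_1: "1 \<le> H"
begin

lemma sqrt_gamma_le: "sqrt \<gamma> \<le> c1 / (2 * c2)"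
  using real_sqrt_le_mono[OF gamma_le] c1_pos c2_pos by simp

lemma sqrt_gamma_less_1: "sqrt \<gamma> < 1"
proof -
  have "c1 / (2 * c2) < 1" using c1_pos c1_less_c2 by simp
  then show ?thesis using sqrt_gamma_le by linarith
qed

lemma gamma_less_1: "\<gamma> < 1"
  using sqrt_gamma_less_1 by simp

lemma c2_gamma_le: "c2 * \<gamma> \<le> c1 / 2"
proof -
  have "c2 * \<gamma> \<le> c2 * (c1 / (2 * c2))\<^sup>2"
    using gamma_le c2_pos by (intro mult_left_mono) auto
  also have "\<dots> = c1 / 2 * (c1 / (2 * c2))"
    using c2_pos by (simp add: power2_eq_square)
  also have "\<dots> \<le> c1 / 2 * 1"
    using c1_pos c1_less_c2 by (intro mult_left_mono) auto
  finally show ?thesis by simp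
qed

lemma emeasure_harnack_annulus_ge:
  assumes "x \<in> space M" "0 < r"
  shows "ennreal (c1 / 2 * r) \<le> emeasure M (annulus (space M) \<delta> x (\<gamma> * r) r)"
proof -
  have "c2 * \<gamma> * r \<le> c1 / 2 * r"
    using assms c2_gamma_le by (intro mult_right_mono) auto
  then have "ennreal (c1 / 2 * r) \<le> ennreal (c1 * r - c2 * (\<gamma> * r))"
    by (intro ennreal_leI) (simp add: algebra_simps)
  also have "\<dots> \<le> emeasure M (annulus (space M) \<delta> x (\<gamma> * r) r)"
    using assms gamma_pos gamma_less_1 by (intro emeasure_annulus_ge) auto
  finally show ?thesis .
qed

lemma annulus_sets [measurable]: "x \<in> space M \<Longrightarrow> annulus (space M) \<delta> x u v \<in> sets M"
  unfolding annulus_def by auto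

lemma kernel_measurable:
  assumes "symmetric_markov_kernel M k" "x \<in> space M"
  shows "k x \<in> borel_measurable M"
proof -
  have "(\<lambda>(x, y). k x y) \<in> borel_measurable (M \<Otimes>\<^sub>M M)"
    using assms by (simp add: symmetric_markov_kernel_def)
  from measurable_Pair2[OF this assms(2)] show ?thesis by simp
qed

text \<open>On an annulus of radius \<open>r\<close> the Harnack condition bounds \<open>k x\<close> by its average, hence by a
  constant times \<open>1 / r\<close> times its mass there; these masses add up to one.\<close>

lemma kernel_le_hlmax:
  assumes k: "symmetric_markov_kernel M k" and ha: "class_Ha M \<delta> \<gamma> H k"
    and x: "x \<in> space M" and h [measurable]: "h \<in> borel_measurable M"
  shows "(\<integral>\<^sup>+ y. ennreal (k x y) * h y \<partial>M) \<le> ennreal (6 * \<tau> * H / c1) * hlmax h x"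
proof -
  have [measurable]: "k x \<in> borel_measurable M"
    using kernel_measurable k x .
  have k0: "\<And>y. y \<in> space M \<Longrightarrow> 0 \<le> k x y"
    using k x by (auto simp: symmetric_markov_kernel_def)
  \<comment> \<open>Integer exponents of both signs are used, so that the half-open annuli
    \<open>A j\<close> tile the whole space apart from the centre.\<close>
  define r where "r j = \<gamma> powr real_of_int j" for j :: int
  define A where "A j = annulus (space M) \<delta> x (\<gamma> * r j) (r j)" for j
  define I where "I j = (\<integral>\<^sup>+ y\<in>A j. ennreal (k x y) \<partial>M)" for j
  define c where "c j = ennreal (2 * H / (c1 * r j)) * I j" for j
  have r0: "0 < r j" for j using gamma_pos by (simp add: r_def)
  have A_sets [measurable]: "A j \<in> sets M" for j
    using x by (simp add: A_def)
  \<comment> \<open>The Harnack inequality between \<open>y\<close> and \<open>z\<close> is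
    integrated over all \<open>z\<close> in the annulus, whose measure is at least
    \<open>c1 / 2 * r j\<close>.\<close>
  have le_c: "ennreal (k x y) \<le> c j" if y: "y \<in> A j" for y j
  proof -
    have ys: "y \<in> space M" using y by (auto simp: A_def annulus_def dball_def)
    have "ennreal (k x y) = ennreal (2 / (c1 * r j)) * (ennreal (k x y) * ennreal (c1 / 2 * r j))"
      using c1_pos r0[of j] k0[OF ys] by (simp add: ennreal_mult[symmetric])
    also have "\<dots> \<le> ennreal (2 / (c1 * r j)) * (ennreal (k x y) * emeasure M (A j))"
      unfolding A_def using x r0 by (intro mult_left_mono emeasure_harnack_annulus_ge) auto
    also have "ennreal (k x y) * emeasure M (A j) = (\<integral>\<^sup>+ z. ennreal (k x y) * indicator (A j) z \<partial>M)"
      by (simp add: nn_integral_cmult_indicator)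
    also have "\<dots> \<le> (\<integral>\<^sup>+ z. ennreal H * (ennreal (k x z) * indicator (A j) z) \<partial>M)"
    proof (intro nn_integral_mono)
      fix z assume z: "z \<in> space M"
      have "k x y \<le> H * k x z" if "z \<in> A j"
        using ha x r0[of j] y that unfolding class_Ha_def A_def by blast
      then show "ennreal (k x y) * indicator (A j) z \<le> ennreal H * (ennreal (k x z) * indicator (A j) z)"
        using H_ge_1 k0[OF z] by (auto simp: indicator_def ennreal_mult[symmetric] intro: ennreal_leI)
    qed
    also have "\<dots> = ennreal H * I j"
      unfolding I_def by (simp add: nn_integral_cmult)
    also have "ennreal (2 / (c1 * r j)) * (ennreal H * I j) = c j"
      unfolding c_def using c1_pos r0[of j] H_ge_1
      by (simp add: mult.assoc[symmetric] ennreal_mult[symmetric])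
    finally show ?thesis by (simp add: mult_left_mono)
  qed
  have mem_A: "\<exists>i. \<forall>j. y \<in> A j \<longleftrightarrow> j = i" if y: "y \<in> space M" "y \<noteq> x" for y
  proof -
    have d: "0 < \<delta> x y"
      using nonneg[OF x y(1)] zero_iff[OF x y(1)] y(2) by force
    \<comment> \<open>\<open>u\<close> is the logarithm of the distance to base
      \<open>\<gamma>\<close>. As \<open>\<gamma> < 1\<close>, the order is reversed and
      \<open>y\<close> lies in \<open>A j\<close> exactly when
      \<open>j < u \<le> j + 1\<close>.\<close>
    define u where "u = ln (\<delta> x y) / ln \<gamma>"
    have lg: "ln \<gamma> < 0" using gamma_pos gamma_less_1 by simp
    have eq: "\<delta> x y = \<gamma> powr u"
      using d gamma_pos gamma_less_1 by (simp add: u_def powr_def)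
    have "\<gamma> * r j = \<gamma> powr (real_of_int j + 1)" for j
      using gamma_pos by (simp add: r_def powr_add)
    then have "y \<in> A j \<longleftrightarrow> real_of_int j < u \<and> u \<le> real_of_int j + 1" for j
      using y gamma_pos gamma_less_1
      by (auto simp: A_def annulus_def mem_B_iff r_def eq powr_def mult_less_cancel_right not_less)
    then have "y \<in> A j \<longleftrightarrow> j = \<lceil>u\<rceil> - 1" for j
      by (smt (verit) ceiling_correct ceiling_unique of_int_1 of_int_diff)
    then show ?thesis by blast
  qed
  have decomp: "(\<integral>\<^sup>+ j. w j * indicator (A j) y \<partial>count_space UNIV) = w i"
    if "\<forall>j. y \<in> A j \<longleftrightarrow> j = i" for w :: "int \<Rightarrow> ennreal" and y i
  proof -
    have "indicator (A j) y = (indicator {i} j :: ennreal)" for j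
      using that by (auto simp: indicator_def)
    then show ?thesis by simp
  qed
  have "(\<integral>\<^sup>+ j. I j \<partial>count_space UNIV) = (\<integral>\<^sup>+ y. \<integral>\<^sup>+ j. ennreal (k x y) * indicator (A j) y \<partial>count_space UNIV \<partial>M)"
    unfolding I_def by (rule nn_integral_count_space_nn_integral[symmetric]) auto
  also have "\<dots> = (\<integral>\<^sup>+ y. ennreal (k x y) \<partial>M)"
  proof (intro nn_integral_cong_AE)
    show "AE y in M. (\<integral>\<^sup>+ j. ennreal (k x y) * indicator (A j) y \<partial>count_space UNIV) = ennreal (k x y)"
      using AE_neq[OF x] AE_space
    proof eventually_elim
      case (elim y)
      then obtain i where i: "\<forall>j. y \<in> A j \<longleftrightarrow> j = i" using mem_A by blast
      show ?case by (rule decomp[OF i])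
    qed
  qed
  also have "\<dots> = 1"
    using k x by (simp add: symmetric_markov_kernel_def)
  finally have sum_I: "(\<integral>\<^sup>+ j. I j \<partial>count_space UNIV) = 1" .
  have "(\<integral>\<^sup>+ y. ennreal (k x y) * h y \<partial>M)
      \<le> (\<integral>\<^sup>+ y. \<integral>\<^sup>+ j. c j * h y * indicator (A j) y \<partial>count_space UNIV \<partial>M)"
  proof (intro nn_integral_mono_AE)
    show "AE y in M. ennreal (k x y) * h y \<le> (\<integral>\<^sup>+ j. c j * h y * indicator (A j) y \<partial>count_space UNIV)"
      using AE_neq[OF x] AE_space
    proof eventually_elim
      case (elim y)
      then obtain i where i: "\<forall>j. y \<in> A j \<longleftrightarrow> j = i" using mem_A by blast
      show ?case
        unfolding decomp[OF i] using le_c[of y i] i by (intro mult_right_mono) auto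
    qed
  qed
  also have "\<dots> = (\<integral>\<^sup>+ j. c j * (\<integral>\<^sup>+ y\<in>A j. h y \<partial>M) \<partial>count_space UNIV)"
    by (subst nn_integral_count_space_nn_integral) (simp_all add: mult.assoc nn_integral_cmult)
  also have "\<dots> \<le> (\<integral>\<^sup>+ j. ennreal (6 * \<tau> * H / c1) * hlmax h x * I j \<partial>count_space UNIV)"
  proof (intro nn_integral_mono)
    fix j
    have "(\<integral>\<^sup>+ y\<in>A j. h y \<partial>M) \<le> (\<integral>\<^sup>+ y\<in>B x (r j). h y \<partial>M)"
      by (intro nn_integral_mono mult_left_mono) (auto simp: indicator_def A_def annulus_def)
    also have "\<dots> \<le> ennreal (3 * \<tau> * r j) * hlmax h x"
      using x r0 by (intro nn_integral_B_le_hlmax)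
    finally have "c j * (\<integral>\<^sup>+ y\<in>A j. h y \<partial>M) \<le> c j * \<dots>"
      by (intro mult_left_mono) auto
    \<comment> \<open>The radius cancels between the kernel bound and the ball integral, so the
      constant is the same on every annulus and only the masses \<open>I j\<close>, of total 1, are
      left to sum.\<close>
    also have "\<dots> = ennreal (2 * H / (c1 * r j)) * ennreal (3 * \<tau> * r j) * hlmax h x * I j"
      by (simp add: c_def mult_ac)
    also have "ennreal (2 * H / (c1 * r j)) * ennreal (3 * \<tau> * r j) = ennreal (6 * \<tau> * H / c1)"
      using r0[of j] c1_pos H_ge_1 tau_pos by (simp add: ennreal_mult[symmetric] field_simps)
    finally show "c j * (\<integral>\<^sup>+ y\<in>A j. h y \<partial>M) \<le> ennreal (6 * \<tau> * H / c1) * hlmax h x * I j" .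
  qed
  also have "\<dots> = ennreal (6 * \<tau> * H / c1) * hlmax h x"
    by (simp add: nn_integral_cmult sum_I)
  finally show ?thesis .
qed

end

section \<open>The topology of the quasi-distance\<close>

text \<open>\<open>openin\<close> inverts \<open>topology\<close> only on predicates satisfying
  \<open>istopology\<close>, so closure under intersections and unions is verified; intersections
  use the smaller of two radii.\<close>

lemma openin_delta_topology:
  "openin (delta_topology X d) U \<longleftrightarrow> U \<subseteq> X \<and> (\<forall>x\<in>U. \<exists>r>0. dball X d x r \<subseteq> U)"
proof -
  let ?P = "\<lambda>U. U \<subseteq> X \<and> (\<forall>x\<in>U. \<exists>r>0. dball X d x r \<subseteq> U)"
  have "?P (U \<inter> V)" if U: "?P U" and V: "?P V" for U V
  proof -
    have "\<exists>r>0. dball X d x r \<subseteq> U \<inter> V" if x: "x \<in> U \<inter> V" for x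
    proof -
      obtain r q where "0 < r" "dball X d x r \<subseteq> U" "0 < q" "dball X d x q \<subseteq> V"
        using U V x by (meson IntE)
      then show ?thesis
        by (intro exI[of _ "min r q"]) (auto simp: dball_def)
    qed
    then show ?thesis using U by auto
  qed
  moreover have "?P (\<Union>\<U>)" if \<U>: "\<forall>U\<in>\<U>. ?P U" for \<U>
  proof -
    have "\<exists>r>0. dball X d x r \<subseteq> \<Union>\<U>" if "x \<in> \<Union>\<U>" for x
      using \<U> that by (meson UnionE Union_upper order_trans)
    then show ?thesis using \<U> by auto
  qed
  ultimately have "istopology ?P"
    unfolding istopology_def by presburger
  then show ?thesis
    by (simp add: delta_topology_def topology_inverse')
qed

lemma continuous_map_delta_topologyD:
  assumes g: "continuous_map (delta_topology X d) euclideanreal g" and x: "x \<in> X" and e: "0 < e"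
  shows "\<exists>r>0. \<forall>y\<in>X. d x y < r \<longrightarrow> \<bar>g y - g x\<bar> < e"
proof -
  have "openin (delta_topology X d) X"
    by (auto simp: openin_delta_topology dball_def intro: exI[of _ 1])
  then have top: "topspace (delta_topology X d) = X"
    by (metis openin_delta_topology openin_subset openin_topspace subset_antisym)
  have "openin (delta_topology X d) {y \<in> X. g y \<in> ball (g x) e}"
    using openin_continuous_map_preimage[OF g, of "ball (g x) e"] by (simp add: top)
  then obtain r where "0 < r" "dball X d x r \<subseteq> {y \<in> X. g y \<in> ball (g x) e}"
    using x e unfolding openin_delta_topology by (metis (mono_tags, lifting) centre_in_ball mem_Collect_eq)
  then show ?thesis
    by (intro exI[of _ r]) (auto simp: dball_def dist_real_def abs_minus_commute)
qed

section \<open>Off-diagonal decay of the kernels\<close>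

context ahlfors_space
begin

text \<open>Dyadic shells: at distances between \<open>t * 2 ^ k\<close> and
  \<open>t * 2 ^ Suc k\<close> the integrand is at most \<open>w k\<close>, while the measure grows
  only linearly in the radius. The products \<open>v k\<close> form a geometric series of ratio
  \<open>2 powr (-s)\<close> that does not involve the centre.\<close>

lemma nn_integral_tail_bound:
  assumes s: "0 < s" and t: "0 < t"
  shows "\<exists>V\<ge>0. \<forall>x\<in>space M.
    (\<integral>\<^sup>+ y\<in>{y. t \<le> \<delta> x y}. ennreal (\<delta> x y powr (-(1 + s))) \<partial>M) \<le> ennreal V"
proof -
  define w where "w k = (t * 2 ^ k) powr (-(1 + s))" for k :: nat
  define v where "v k = 2 * c2 * t powr (-s) * (2 powr (-s)) ^ k" for k :: nat
  have wv: "w k * (c2 * (t * 2 ^ Suc k)) = v k" for k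
  proof -
    have "w k * (t * 2 ^ k) = (t * 2 ^ k) powr (-(1 + s) + 1)"
      unfolding w_def using t by (subst powr_add) (simp add: powr_one)
    also have "\<dots> = t powr (-s) * (2 ^ k) powr (-s)"
      using t by (simp add: powr_mult)
    also have "(2 ^ k) powr (-s) = (2 powr (-s)) ^ k"
      by (simp add: powr_realpow[symmetric] powr_powr mult.commute)
    finally show ?thesis
      by (simp add: v_def mult_ac)
  qed
  have term_le_suminf: "f k \<le> suminf f" for f :: "nat \<Rightarrow> ennreal" and k
    using sum_le_suminf[of f "{k}"] by simp
  have v0: "0 \<le> v k" for k
    using c2_pos by (simp add: v_def)
  have "(2::real) powr (-s) < 1"
    using s by (simp add: powr_less_one)
  then have sv: "summable v"
    unfolding v_def by (intro summable_mult summable_geometric) auto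
  have "(\<integral>\<^sup>+ y\<in>{y. t \<le> \<delta> x y}. ennreal (\<delta> x y powr (-(1 + s))) \<partial>M) \<le> ennreal (suminf v)"
    if x: "x \<in> space M" for x
  proof -
    have "(\<integral>\<^sup>+ y\<in>{y. t \<le> \<delta> x y}. ennreal (\<delta> x y powr (-(1 + s))) \<partial>M)
        \<le> (\<integral>\<^sup>+ y. (\<Sum>k. ennreal (w k) * indicator (B x (t * 2 ^ Suc k)) y) \<partial>M)"
    proof (intro nn_integral_mono)
      fix y assume y: "y \<in> space M"
      show "ennreal (\<delta> x y powr (-(1 + s))) * indicator {y. t \<le> \<delta> x y} y
        \<le> (\<Sum>k. ennreal (w k) * indicator (B x (t * 2 ^ Suc k)) y)"
      proof (cases "t \<le> \<delta> x y")
        case True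
        \<comment> \<open>The least such \<open>n\<close> is positive because
          \<open>t \<le> \<delta> x y\<close>; its predecessor \<open>k\<close> indexes the shell
          that contains \<open>y\<close>.\<close>
        define n where "n = (LEAST n. \<delta> x y < t * 2 ^ n)"
        have "\<exists>n. \<delta> x y / t < 2 ^ n"
          by (intro real_arch_pow) simp
        then have ex: "\<exists>n. \<delta> x y < t * 2 ^ n"
          using t by (simp add: pos_divide_less_eq mult.commute)
        have n: "\<delta> x y < t * 2 ^ n"
          unfolding n_def using ex by (rule LeastI_ex)
        obtain k where k: "n = Suc k"
          using n True by (cases n) auto
        have "\<not> \<delta> x y < t * 2 ^ k"
          unfolding n_def using not_less_Least[of k "\<lambda>n. \<delta> x y < t * 2 ^ n"] k by (simp add: n_def)
        then have "\<delta> x y powr (-(1 + s)) \<le> w k"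
          unfolding w_def using t s by (intro powr_mono2') auto
        then have "ennreal (\<delta> x y powr (-(1 + s))) * indicator {y. t \<le> \<delta> x y} y
            \<le> ennreal (w k) * indicator (B x (t * 2 ^ Suc k)) y"
          using y n k True by (auto simp: mem_B_iff intro: ennreal_leI)
        also have "\<dots> \<le> (\<Sum>k. ennreal (w k) * indicator (B x (t * 2 ^ Suc k)) y)"
          by (rule term_le_suminf)
        finally show ?thesis .
      qed simp
    qed
    also have "\<dots> = (\<Sum>k. \<integral>\<^sup>+ y. ennreal (w k) * indicator (B x (t * 2 ^ Suc k)) y \<partial>M)"
      using x by (intro nn_integral_suminf) simp
    also have "\<dots> = (\<Sum>k. ennreal (w k) * emeasure M (B x (t * 2 ^ Suc k)))"
      using x by (simp add: nn_integral_cmult_indicator del: power_Suc)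
    also have "\<dots> \<le> (\<Sum>k. ennreal (v k))"
    proof (intro suminf_le summableI)
      fix k
      have "ennreal (w k) * emeasure M (B x (t * 2 ^ Suc k)) \<le> ennreal (w k) * ennreal (c2 * (t * 2 ^ Suc k))"
        using x t by (intro mult_left_mono ball_le) auto
      also have "\<dots> = ennreal (v k)"
        unfolding wv[symmetric] using c2_pos t by (subst ennreal_mult) (auto simp: w_def)
      finally show "ennreal (w k) * emeasure M (B x (t * 2 ^ Suc k)) \<le> ennreal (v k)" .
    qed
    also have "\<dots> = ennreal (suminf v)"
      using v0 sv by (intro suminf_ennreal2)
    finally show ?thesis .
  qed
  then show ?thesis
    using suminf_nonneg[OF sv v0] by blast
qed

end

context harnack_space
begin

text \<open>The bound on \<open>\<gamma>\<close> makes the annuli with outer radii \<open>r\<close> and \<open>sqrt \<gamma> * r\<close> overlap in positive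
  measure, so that the Harnack condition can be chained from one to the next.\<close>

lemma harnack_chain:
  assumes ha: "class_Ha M \<delta> \<gamma> H k" and x: "x \<in> space M" and r: "0 < r"
    and base: "\<And>y. y \<in> annulus (space M) \<delta> x (\<gamma> * r) r \<Longrightarrow> k x y \<le> b"
    and y: "y \<in> annulus (space M) \<delta> x (\<gamma> * (r * sqrt \<gamma> ^ n)) (r * sqrt \<gamma> ^ n)"
  shows "k x y \<le> H ^ n * b"
  using y
proof (induction n arbitrary: y)
  case 0
  then show ?case using base by simp
next
  case (Suc n)
  define q where "q = r * sqrt \<gamma> ^ n"
  have q: "0 < q" using r gamma_pos by (simp add: q_def)
  have sg: "0 < sqrt \<gamma>" using gamma_pos by simp
  have qS: "r * sqrt \<gamma> ^ Suc n = sqrt \<gamma> * q" by (simp add: q_def mult_ac)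
  have gs: "\<gamma> = sqrt \<gamma> * sqrt \<gamma>" using gamma_pos by simp
  have le: "\<gamma> * q \<le> sqrt \<gamma> * q"
    using q sqrt_gamma_less_1 sg mult_left_mono[of "sqrt \<gamma>" 1 "sqrt \<gamma>"] by (subst gs) simp
  have "c2 * sqrt \<gamma> \<le> c1 / 2"
    using mult_left_mono[OF sqrt_gamma_le, of c2] c2_pos by simp
  then have "c2 * sqrt \<gamma> * (sqrt \<gamma> * q) \<le> c1 / 2 * (sqrt \<gamma> * q)"
    using sg q by (intro mult_right_mono) auto
  moreover have "c2 * sqrt \<gamma> * (sqrt \<gamma> * q) = c2 * (\<gamma> * q)"
    by (subst (3) gs) (simp add: mult_ac)
  moreover have "0 < c1 * (sqrt \<gamma> * q)"
    using c1_pos sg q by simp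
  ultimately have "0 < c1 * (sqrt \<gamma> * q) - c2 * (\<gamma> * q)" by simp
  moreover have "ennreal (c1 * (sqrt \<gamma> * q) - c2 * (\<gamma> * q)) \<le> emeasure M (annulus (space M) \<delta> x (\<gamma> * q) (sqrt \<gamma> * q))"
    using x q gamma_pos le by (intro emeasure_annulus_ge) auto
  ultimately have "emeasure M (annulus (space M) \<delta> x (\<gamma> * q) (sqrt \<gamma> * q)) \<noteq> 0"
    by (metis ennreal_eq_0_iff le_zero_eq not_less)
  then obtain z where z: "z \<in> annulus (space M) \<delta> x (\<gamma> * q) (sqrt \<gamma> * q)"
    by (metis emeasure_empty ex_in_conv)
  \<comment> \<open>The point \<open>z\<close> of the overlap belongs to the annulus of outer radius
    \<open>q\<close>, where the induction hypothesis applies, and to the next one, where the Harnack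
    condition compares it with \<open>y\<close>.\<close>
  have "sqrt \<gamma> * q \<le> 1 * q"
    using sqrt_gamma_less_1 q by (intro mult_right_mono) auto
  then have z1: "z \<in> annulus (space M) \<delta> x (\<gamma> * q) q"
    using z by (auto simp: annulus_def mem_B_iff)
  have "\<gamma> * (sqrt \<gamma> * q) \<le> \<gamma> * (1 * q)"
    using sqrt_gamma_less_1 q gamma_pos by (intro mult_left_mono mult_right_mono) auto
  then have z2: "z \<in> annulus (space M) \<delta> x (\<gamma> * (sqrt \<gamma> * q)) (sqrt \<gamma> * q)"
    using z by (auto simp: annulus_def mem_B_iff)
  have "k x y \<le> H * k x z"
    using ha x Suc.prems z2 q sg unfolding class_Ha_def qS by (meson mult_pos_pos)
  also have "\<dots> \<le> H * (H ^ n * b)"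
    using Suc.IH[of z] z1 H_ge_1 unfolding q_def by (intro mult_left_mono) auto
  finally show ?case by (simp add: mult_ac)
qed

text \<open>Beyond \<open>r0\<close> the decay hypothesis applies directly. Closer in, at most
  \<open>N\<close> links of the chain lead from distances around \<open>r0\<close> down to
  \<open>t\<close>, and \<open>N\<close> depends neither on the kernel nor on the points; hence one
  constant serves all of them and the factor \<open>a\<close> is kept.\<close>

lemma kernel_decay:
  assumes s: "0 < s" and R: "0 < R" and t: "0 < t"
  shows "\<exists>C\<ge>0. \<forall>a k x y. 0 < a \<longrightarrow> class_Ha M \<delta> \<gamma> H k \<longrightarrow> class_S M \<delta> s a R k \<longrightarrow>
    x \<in> space M \<longrightarrow> y \<in> space M \<longrightarrow> t \<le> \<delta> x y \<longrightarrow> k x y \<le> a * C * \<delta> x y powr (-(1 + s))"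
proof -
  \<comment> \<open>The inner radius of the first annulus is then \<open>2 * R\<close>, so the whole
    annulus satisfies the strict condition \<open>\<delta> > R\<close> and its kernel values are
    bounded by \<open>a * c\<close>.\<close>
  define r0 where "r0 = 2 * R / \<gamma>"
  have r0: "0 < r0" "\<gamma> * r0 = 2 * R" using R gamma_pos by (auto simp: r0_def)
  have "\<gamma> * r0 \<le> 1 * r0"
    using gamma_less_1 r0(1) by (intro mult_right_mono) auto
  then have Rr0: "R < r0" using r0 R by simp
  define c where "c = (2 * R) powr (-(1 + s))"
  obtain N where "sqrt \<gamma> ^ N < t / r0"
    using real_arch_pow_inv[of "t / r0" "sqrt \<gamma>"] t r0 sqrt_gamma_less_1 by auto
  then have N: "r0 * sqrt \<gamma> ^ N < t"
    using r0 by (simp add: pos_less_divide_eq mult.commute)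
  \<comment> \<open>The summand 1 covers distances beyond \<open>r0\<close>. The other one covers
    the chained region, where the factor \<open>r0 powr (1 + s)\<close> turns a constant bound into
    one by \<open>\<delta> x y powr (-(1 + s))\<close>, since
    \<open>\<delta> x y < r0\<close>.\<close>
  define C where "C = 1 + H ^ N * c * r0 powr (1 + s)"
  have HN: "0 \<le> H ^ N * c * r0 powr (1 + s)"
    using H_ge_1 by (simp add: c_def)
  have "k x y \<le> a * C * \<delta> x y powr (-(1 + s))"
    if a: "0 < a" and ha: "class_Ha M \<delta> \<gamma> H k" and S: "class_S M \<delta> s a R k"
      and x: "x \<in> space M" and y: "y \<in> space M" and ty: "t \<le> \<delta> x y" for a k x y
  proof (cases "\<delta> x y < r0")
    case False
    then have "k x y \<le> a * \<delta> x y powr (-(1 + s))"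
      using S x y Rr0 by (auto simp: class_S_def)
    also have "\<dots> = a * 1 * \<delta> x y powr (-(1 + s))" by simp
    also have "\<dots> \<le> a * C * \<delta> x y powr (-(1 + s))"
      using a HN by (intro mult_right_mono mult_left_mono) (auto simp: C_def)
    finally show ?thesis .
  next
    case True
    \<comment> \<open>The first chain radius not exceeding the distance. It is not the zeroth, so
      its predecessor \<open>n\<close> exists and is the outer radius index of an annulus containing
      \<open>y\<close>.\<close>
    define m where "m = (LEAST m. r0 * sqrt \<gamma> ^ m \<le> \<delta> x y)"
    have PN: "r0 * sqrt \<gamma> ^ N \<le> \<delta> x y" using N ty by simp
    have mN: "m \<le> N"
      unfolding m_def using PN by (rule Least_le)
    have m: "r0 * sqrt \<gamma> ^ m \<le> \<delta> x y"
      unfolding m_def using PN by (rule LeastI)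
    obtain n where n: "m = Suc n"
      using m True by (cases m) auto
    have less: "\<delta> x y < r0 * sqrt \<gamma> ^ n"
      using not_less_Least[of n "\<lambda>m. r0 * sqrt \<gamma> ^ m \<le> \<delta> x y"] n by (simp add: m_def)
    have "\<gamma> * (r0 * sqrt \<gamma> ^ n) = sqrt \<gamma> * (r0 * sqrt \<gamma> ^ m)"
      using gamma_pos by (simp add: n mult_ac real_sqrt_mult_self)
    also have "\<dots> \<le> 1 * (r0 * sqrt \<gamma> ^ m)"
      using sqrt_gamma_less_1 gamma_pos r0 by (intro mult_right_mono) auto
    finally have ann: "y \<in> annulus (space M) \<delta> x (\<gamma> * (r0 * sqrt \<gamma> ^ n)) (r0 * sqrt \<gamma> ^ n)"
      using m less y by (simp add: annulus_def mem_B_iff)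
    have base: "k x z \<le> a * c" if z: "z \<in> annulus (space M) \<delta> x (\<gamma> * r0) r0" for z
    proof -
      have z': "z \<in> space M" "2 * R \<le> \<delta> x z"
        using z r0 by (auto simp: annulus_def mem_B_iff)
      then have "k x z \<le> a * \<delta> x z powr (-(1 + s))"
        using S x R by (auto simp: class_S_def)
      also have "\<dots> \<le> a * c"
        unfolding c_def using a z' R s by (intro mult_left_mono powr_mono2') auto
      finally show ?thesis .
    qed
    have "k x y \<le> H ^ n * (a * c)"
      by (rule harnack_chain[OF ha x r0(1) base ann])
    also have "\<dots> \<le> H ^ N * (a * c)"
      using H_ge_1 mN n a by (intro mult_right_mono power_increasing) (auto simp: c_def)
    also have "\<dots> = a * (H ^ N * c * (r0 powr (1 + s) * r0 powr (-(1 + s))))"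
      using r0 by (simp add: powr_add[symmetric] mult_ac)
    also have "\<dots> \<le> a * (H ^ N * c * (r0 powr (1 + s) * \<delta> x y powr (-(1 + s))))"
      using a H_ge_1 True t ty s by (intro mult_left_mono powr_mono2') (auto simp: c_def)
    also have "\<dots> = a * (H ^ N * c * r0 powr (1 + s)) * \<delta> x y powr (-(1 + s))"
      by (simp add: mult_ac)
    also have "\<dots> \<le> a * C * \<delta> x y powr (-(1 + s))"
      using a by (intro mult_right_mono mult_left_mono) (auto simp: C_def)
    finally show ?thesis .
  qed
  moreover have "0 \<le> C" using HN by (simp add: C_def)
  ultimately show ?thesis by blast
qed

end

section \<open>Marcinkiewicz interpolation for the maximal function\<close>

text \<open>Used with the exponent \<open>p - 1\<close> for the layer-cake formula and with
  \<open>p - 2\<close> after the weak type bound has cost one power of \<open>u\<close>. The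
  condition \<open>-1 < a\<close> for the latter is exactly \<open>1 < p\<close>.\<close>

lemma nn_integral_powr_below:
  fixes a c :: real
  assumes "-1 < a" "0 \<le> c"
  shows "(\<integral>\<^sup>+ u. (if 0 < u \<and> u < c then ennreal (u powr a) else 0) \<partial>lborel) = ennreal (c powr (a + 1) / (a + 1))"
proof -
  have "(\<integral>\<^sup>+ u. (if 0 < u \<and> u < c then ennreal (u powr a) else 0) \<partial>lborel)
      = (\<integral>\<^sup>+ u. ennreal (u powr a) * indicator {0..c} u \<partial>lborel)"
  proof (intro nn_integral_cong_AE)
    show "AE u in lborel. (if 0 < u \<and> u < c then ennreal (u powr a) else 0) = ennreal (u powr a) * indicator {0..c} u"
      using AE_lborel_singleton[of c] AE_lborel_singleton[of 0]
      by eventually_elim (auto simp: indicator_def)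
  qed
  also have "\<dots> = ennreal (c powr (a + 1) / (a + 1))"
    using has_integral_powr_from_0[OF assms] by (intro nn_integral_has_integral_lebesgue') auto
  finally show ?thesis .
qed

lemma le_one_plus_powr:
  fixes a p :: real
  assumes "0 \<le> a" "1 \<le> p"
  shows "a \<le> a powr p + 1"
proof (cases "a \<le> 1")
  case False
  then have "a powr 1 \<le> a powr p" using assms by (intro powr_mono) auto
  then show ?thesis using assms by simp
qed (simp add: add_increasing)

context ahlfors_space
begin

lemma sigma_finite_M: "sigma_finite_measure M"
proof -
  obtain x where x: "x \<in> space M" using space_nonempty by blast
  show ?thesis
  proof
    show "\<exists>A. countable A \<and> A \<subseteq> sets M \<and> \<Union> A = space M \<and> (\<forall>a\<in>A. emeasure M a \<noteq> \<infinity>)"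
      using x space_eq_UN_B[OF x] emeasure_B_finite[OF x]
      by (intro exI[of _ "range (\<lambda>n. B x (real n))"]) (auto simp: less_top)
  qed
qed

abbreviation hlabs :: "('a \<Rightarrow> real) \<Rightarrow> 'a \<Rightarrow> ennreal" where
  "hlabs f \<equiv> hlmax (\<lambda>y. ennreal \<bar>f y\<bar>)"

text \<open>Values of \<open>f\<close> below \<open>u / (2 * c2)\<close> raise the maximal function
  by at most \<open>u / 2\<close>. The weak type bound at height \<open>u / 2\<close> is thus
  applied to the large values alone.\<close>

lemma emeasure_hlabs_gt:
  assumes [measurable]: "f \<in> borel_measurable M" and u: "0 < u"
  shows "emeasure M {x \<in> space M. ennreal u < hlabs f x}
    \<le> ennreal (2 * c2 * vitali / u) * (\<integral>\<^sup>+ y. (if u < 2 * c2 * \<bar>f y\<bar> then ennreal \<bar>f y\<bar> else 0) \<partial>M)"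
proof -
  define h where "h y = (if u < 2 * c2 * \<bar>f y\<bar> then ennreal \<bar>f y\<bar> else 0)" for y
  have [measurable]: "h \<in> borel_measurable M" unfolding h_def[abs_def] by measurable
  have le: "hlabs f x \<le> hlmax h x + ennreal (u / 2)" for x
  proof -
    have "ennreal \<bar>f y\<bar> \<le> h y + ennreal (u / (2 * c2))" for y
      using c2_pos by (auto simp: h_def field_simps intro!: ennreal_leI)
    then have "hlabs f x \<le> hlmax h x + ennreal (c2 * (u / (2 * c2)))"
      using u c2_pos by (intro hlmax_le_add_const) auto
    then show ?thesis using c2_pos by simp
  qed
  have "{x \<in> space M. ennreal u < hlabs f x} \<subseteq> {x \<in> space M. ennreal (u / 2) < hlmax h x}"
  proof (intro subsetI CollectI conjI)
    fix x assume x: "x \<in> {x \<in> space M. ennreal u < hlabs f x}"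
    show "ennreal (u / 2) < hlmax h x"
    proof (rule ccontr)
      assume "\<not> ennreal (u / 2) < hlmax h x"
      then have "hlmax h x + ennreal (u / 2) \<le> ennreal (u / 2) + ennreal (u / 2)"
        by (intro add_right_mono) simp
      also have "\<dots> = ennreal u"
        using u by (simp add: ennreal_plus[symmetric] del: ennreal_plus)
      finally have "hlabs f x \<le> ennreal u" using le[of x] by (rule order_trans[rotated])
      then show False using x by (simp add: leD)
    qed
  qed simp
  then have "emeasure M {x \<in> space M. ennreal u < hlabs f x} \<le> emeasure M {x \<in> space M. ennreal (u / 2) < hlmax h x}"
    by (intro emeasure_mono) auto
  also have "\<dots> \<le> ennreal (c2 * vitali / (u / 2)) * (\<integral>\<^sup>+ y. h y \<partial>M)"
    using u by (intro hlmax_weak_type) auto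
  also have "c2 * vitali / (u / 2) = 2 * c2 * vitali / u" by simp
  finally show ?thesis unfolding h_def .
qed

text \<open>Marcinkiewicz interpolation: integrate the previous estimate against \<open>p * u powr (p - 1)\<close>
  and exchange the order of integration.\<close>

lemma hlabs_strong_type:
  assumes [measurable]: "f \<in> borel_measurable M" and p: "1 < p"
  shows "(\<integral>\<^sup>+ x. ennreal (enn2real (hlabs f x) powr p) \<partial>M)
    \<le> ennreal (p * (2 * c2 * vitali) * (2 * c2) powr (p - 1) / (p - 1)) * (\<integral>\<^sup>+ x. ennreal (\<bar>f x\<bar> powr p) \<partial>M)"
proof -
  interpret sigma_finite_measure M by (rule sigma_finite_M)
  interpret pair_sigma_finite M lborel ..
  \<comment> \<open>\<open>enn2real\<close> sends infinity to 0, which only shrinks the superlevel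
    sets; for \<open>f\<close> in \<open>L^p\<close> the maximal function is finite almost
    everywhere, so nothing is lost there.\<close>
  define g where "g x = enn2real (hlabs f x)" for x
  have [measurable]: "g \<in> borel_measurable M" unfolding g_def[abs_def] by measurable
  define q where "q = 2 * c2 * vitali"
  have q: "0 < q" using c2_pos vitali_pos by (simp add: q_def)
  let ?F = "\<lambda>y u. if u < 2 * c2 * \<bar>f y\<bar> then ennreal \<bar>f y\<bar> else 0"
  have "(\<integral>\<^sup>+ x. ennreal (g x powr p) \<partial>M)
      = (\<integral>\<^sup>+ x. ennreal p * (\<integral>\<^sup>+ u. (if 0 < u \<and> u < g x then ennreal (u powr (p - 1)) else 0) \<partial>lborel) \<partial>M)"
    using p by (intro nn_integral_cong)
      (subst nn_integral_powr_below, auto simp: g_def ennreal_mult[symmetric])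
  also have "\<dots> = (\<integral>\<^sup>+ x. \<integral>\<^sup>+ u. (if 0 < u \<and> u < g x then ennreal (p * u powr (p - 1)) else 0) \<partial>lborel \<partial>M)"
    using p by (subst nn_integral_cmult[symmetric]) (auto intro!: nn_integral_cong simp: ennreal_mult)
  also have "\<dots> = (\<integral>\<^sup>+ u. \<integral>\<^sup>+ x. (if 0 < u \<and> u < g x then ennreal (p * u powr (p - 1)) else 0) \<partial>M \<partial>lborel)"
    by (rule Fubini'[symmetric]) measurable
  also have "\<dots> \<le> (\<integral>\<^sup>+ u. \<integral>\<^sup>+ y. (if 0 < u then ennreal (p * q * u powr (p - 2)) * ?F y u else 0) \<partial>M \<partial>lborel)"
  proof (rule nn_integral_mono)
    fix u :: real
    show "(\<integral>\<^sup>+ x. (if 0 < u \<and> u < g x then ennreal (p * u powr (p - 1)) else 0) \<partial>M)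
       \<le> (\<integral>\<^sup>+ y. (if 0 < u then ennreal (p * q * u powr (p - 2)) * ?F y u else 0) \<partial>M)"
    proof (cases "0 < u")
      case True
      have "(\<integral>\<^sup>+ x. (if 0 < u \<and> u < g x then ennreal (p * u powr (p - 1)) else 0) \<partial>M)
          = (\<integral>\<^sup>+ x. ennreal (p * u powr (p - 1)) * indicator {x \<in> space M. u < g x} x \<partial>M)"
        using True by (intro nn_integral_cong) (auto simp: indicator_def)
      also have "\<dots> = ennreal (p * u powr (p - 1)) * emeasure M {x \<in> space M. u < g x}"
        by (simp add: nn_integral_cmult_indicator)
      also have "\<dots> \<le> ennreal (p * u powr (p - 1)) * emeasure M {x \<in> space M. ennreal u < hlabs f x}"
      proof (intro mult_left_mono emeasure_mono subsetI CollectI conjI)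
        fix x assume x: "x \<in> {x \<in> space M. u < g x}"
        show "ennreal u < hlabs f x"
          using x True by (cases "hlabs f x") (auto simp: g_def ennreal_less_iff)
      qed auto
      also have "\<dots> \<le> ennreal (p * u powr (p - 1)) * (ennreal (q / u) * (\<integral>\<^sup>+ y. ?F y u \<partial>M))"
        unfolding q_def using True by (intro mult_left_mono emeasure_hlabs_gt) auto
      also have "\<dots> = ennreal (p * q * u powr (p - 2)) * (\<integral>\<^sup>+ y. ?F y u \<partial>M)"
      proof -
        have "u powr (p - 1) / u = u powr (p - 2)"
          using True powr_diff[of u "p - 1" 1] by simp
        then have "p * u powr (p - 1) * (q / u) = p * q * u powr (p - 2)"
          by (metis (no_types, opaque_lifting) mult.assoc mult.commute times_divide_eq_right)
        then show ?thesis
          using p q True by (simp add: mult.assoc[symmetric] ennreal_mult[symmetric])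
      qed
      also have "\<dots> = (\<integral>\<^sup>+ y. ennreal (p * q * u powr (p - 2)) * ?F y u \<partial>M)"
        by (rule nn_integral_cmult[symmetric]) measurable
      finally show ?thesis using True by simp
    qed simp
  qed
  \<comment> \<open>After exchanging back, \<open>y\<close> is fixed and the truncation cuts the
    \<open>u\<close>-integral at \<open>2 * c2 * \<bar>f y\<bar>\<close>. It contributes the power
    \<open>p - 1\<close> of \<open>\<bar>f y\<bar>\<close>, and the remaining factor completes the
    power \<open>p\<close>.\<close>
  also have "\<dots> = (\<integral>\<^sup>+ y. \<integral>\<^sup>+ u. (if 0 < u then ennreal (p * q * u powr (p - 2)) * ?F y u else 0) \<partial>lborel \<partial>M)"
    by (rule Fubini') measurable
  also have "\<dots> = (\<integral>\<^sup>+ y. ennreal (p * q * (2 * c2) powr (p - 1) / (p - 1)) * ennreal (\<bar>f y\<bar> powr p) \<partial>M)"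
  proof (rule nn_integral_cong)
    fix y
    have "(\<integral>\<^sup>+ u. (if 0 < u then ennreal (p * q * u powr (p - 2)) * ?F y u else 0) \<partial>lborel)
       = (\<integral>\<^sup>+ u. ennreal (p * q * \<bar>f y\<bar>) * (if 0 < u \<and> u < 2 * c2 * \<bar>f y\<bar> then ennreal (u powr (p - 2)) else 0) \<partial>lborel)"
      using p q by (intro nn_integral_cong) (auto simp: ennreal_mult[symmetric] mult_ac)
    also have "\<dots> = ennreal (p * q * \<bar>f y\<bar>) * ennreal ((2 * c2 * \<bar>f y\<bar>) powr (p - 2 + 1) / (p - 2 + 1))"
      using p c2_pos by (subst nn_integral_cmult) (auto simp: nn_integral_powr_below)
    also have "\<dots> = ennreal (p * q * (2 * c2) powr (p - 1) / (p - 1) * (\<bar>f y\<bar> powr 1 * \<bar>f y\<bar> powr (p - 1)))"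
      using p q c2_pos by (simp add: ennreal_mult[symmetric] powr_mult mult_ac)
    also have "\<bar>f y\<bar> powr 1 * \<bar>f y\<bar> powr (p - 1) = \<bar>f y\<bar> powr p"
      by (simp only: powr_add[symmetric]) simp
    finally show "(\<integral>\<^sup>+ u. (if 0 < u then ennreal (p * q * u powr (p - 2)) * ?F y u else 0) \<partial>lborel)
       = ennreal (p * q * (2 * c2) powr (p - 1) / (p - 1)) * ennreal (\<bar>f y\<bar> powr p)"
      using p q by (simp add: ennreal_mult[symmetric])
  qed
  also have "\<dots> = ennreal (p * q * (2 * c2) powr (p - 1) / (p - 1)) * (\<integral>\<^sup>+ y. ennreal (\<bar>f y\<bar> powr p) \<partial>M)"
    by (rule nn_integral_cmult) measurable
  finally show ?thesis unfolding g_def q_def .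
qed

lemma in_Lp_nn_integral:
  assumes "in_Lp M p f"
  shows "(\<integral>\<^sup>+ x. ennreal (\<bar>f x\<bar> powr p) \<partial>M) = ennreal (\<integral> x. \<bar>f x\<bar> powr p \<partial>M)"
  using assms by (intro nn_integral_eq_integral) (auto simp: in_Lp_def)

text \<open>\<open>\<bar>f\<bar>\<close> is at most \<open>\<bar>f\<bar> powr p + 1\<close>; the
  first term is integrable and the constant adds at most \<open>c2\<close> to the maximal
  function.\<close>

lemma hlabs_finite_AE_Lp:
  assumes f: "in_Lp M p f" and p: "1 \<le> p"
  shows "AE x in M. hlabs f x < \<infinity>"
proof -
  have [measurable]: "f \<in> borel_measurable M" using f by (simp add: in_Lp_def)
  have "ennreal \<bar>f y\<bar> \<le> ennreal (\<bar>f y\<bar> powr p) + ennreal 1" for y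
    using le_one_plus_powr[of "\<bar>f y\<bar>" p] p by (subst ennreal_plus[symmetric]) (auto intro: ennreal_leI simp del: ennreal_plus ennreal_1)
  then have le: "hlabs f x \<le> hlmax (\<lambda>y. ennreal (\<bar>f y\<bar> powr p)) x + ennreal (c2 * 1)" for x
    by (intro hlmax_le_add_const) auto
  have "AE x in M. hlmax (\<lambda>y. ennreal (\<bar>f y\<bar> powr p)) x < \<infinity>"
    using in_Lp_nn_integral[OF f] by (intro hlmax_finite_AE) auto
  then show ?thesis
  proof eventually_elim
    case (elim x)
    then have "hlmax (\<lambda>y. ennreal (\<bar>f y\<bar> powr p)) x + ennreal (c2 * 1) < \<infinity>"
      by (simp add: ennreal_add_less_top)
    then show ?case using le[of x] by (rule le_less_trans[rotated])
  qed
qed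

lemma hlabs_finite_AE:
  assumes "integrable M f"
  shows "AE x in M. hlabs f x < \<infinity>"
  using assms by (intro hlmax_finite_AE) (auto simp: integrable_iff_bounded)

end

section \<open>Concentration, and convergence for continuous integrable functions\<close>

lemma abs_integral_le_integral_AE:
  fixes f g :: "'a \<Rightarrow> real"
  assumes "integrable M f" "integrable M g" "AE x in M. \<bar>f x\<bar> \<le> g x"
  shows "\<bar>\<integral>x. f x \<partial>M\<bar> \<le> (\<integral>x. g x \<partial>M)"
proof -
  have "\<bar>\<integral>x. f x \<partial>M\<bar> \<le> (\<integral>x. \<bar>f x\<bar> \<partial>M)"
    by (rule integral_abs_bound)
  also have "\<dots> \<le> (\<integral>x. g x \<partial>M)"
    using assms by (intro integral_mono_AE) auto
  finally show ?thesis .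
qed

locale approximate_identity = harnack_space +
  fixes s R :: real and K :: "real \<Rightarrow> 'a \<Rightarrow> 'a \<Rightarrow> real"
  assumes s_pos: "0 < s" and R_pos: "0 < R"
    and markov: "\<And>\<alpha>. 0 < \<alpha> \<Longrightarrow> \<alpha> < 1 \<Longrightarrow> symmetric_markov_kernel M (K \<alpha>)"
    and harnack: "\<And>\<alpha>. 0 < \<alpha> \<Longrightarrow> \<alpha> < 1 \<Longrightarrow> class_Ha M \<delta> \<gamma> H (K \<alpha>)"
    and decay: "\<And>\<alpha>. 0 < \<alpha> \<Longrightarrow> \<alpha> < 1 \<Longrightarrow> class_S M \<delta> s \<alpha> R (K \<alpha>)"
begin

definition CK :: real where "CK = 6 * \<tau> * H / c1"

lemma CK_pos: "0 < CK"
  using tau_pos H_ge_1 c1_pos by (simp add: CK_def)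

lemma K_nonneg: "0 < \<alpha> \<Longrightarrow> \<alpha> < 1 \<Longrightarrow> x \<in> space M \<Longrightarrow> y \<in> space M \<Longrightarrow> 0 \<le> K \<alpha> x y"
  using markov by (simp add: symmetric_markov_kernel_def)

lemma K_measurable: "0 < \<alpha> \<Longrightarrow> \<alpha> < 1 \<Longrightarrow> x \<in> space M \<Longrightarrow> K \<alpha> x \<in> borel_measurable M"
  using markov kernel_measurable by blast

lemma nn_integral_K: "0 < \<alpha> \<Longrightarrow> \<alpha> < 1 \<Longrightarrow> x \<in> space M \<Longrightarrow> (\<integral>\<^sup>+ y. ennreal (K \<alpha> x y) \<partial>M) = 1"
  using markov by (simp add: symmetric_markov_kernel_def)

lemma K_has_integral:
  assumes "0 < \<alpha>" "\<alpha> < 1" "x \<in> space M"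
  shows "integrable M (K \<alpha> x)" "(\<integral> y. K \<alpha> x y \<partial>M) = 1"
proof -
  have "has_bochner_integral M (K \<alpha> x) 1"
    using assms K_measurable K_nonneg nn_integral_K
    by (intro has_bochner_integral_nn_integral) auto
  then show "integrable M (K \<alpha> x)" "(\<integral> y. K \<alpha> x y \<partial>M) = 1"
    by (auto simp: has_bochner_integral_iff)
qed

lemma delta_measurable [measurable]: "x \<in> space M \<Longrightarrow> \<delta> x \<in> borel_measurable M"
proof -
  assume x: "x \<in> space M"
  have "{y \<in> space M. \<delta> x y < r} \<in> sets M" for r
    using B_sets[OF x] by (simp add: dball_def)
  then show ?thesis
    by (auto simp: borel_measurable_iff_less)
qed

text \<open>The decay bound is integrated over the far region for the mass and evaluated at distance
  \<open>t\<close> for the supremum. One \<open>W\<close> serves both.\<close>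

lemma far_mass_and_sup_bound:
  assumes t: "0 < t"
  shows "\<exists>W\<ge>0. \<forall>\<alpha> x. 0 < \<alpha> \<longrightarrow> \<alpha> < 1 \<longrightarrow> x \<in> space M \<longrightarrow>
    (\<integral>\<^sup>+ y. ennreal (K \<alpha> x y) * indicator {y. \<delta> x y \<ge> t} y \<partial>M) \<le> ennreal (\<alpha> * W) \<and>
    (\<forall>y\<in>space M. t \<le> \<delta> x y \<longrightarrow> K \<alpha> x y \<le> \<alpha> * W)"
proof -
  obtain C where C: "0 \<le> C" "\<And>a k x y. 0 < a \<Longrightarrow> class_Ha M \<delta> \<gamma> H k \<Longrightarrow> class_S M \<delta> s a R k \<Longrightarrow>
    x \<in> space M \<Longrightarrow> y \<in> space M \<Longrightarrow> t \<le> \<delta> x y \<Longrightarrow> k x y \<le> a * C * \<delta> x y powr (-(1 + s))"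
    using kernel_decay[OF s_pos R_pos t] by blast
  obtain V where V: "0 \<le> V" "\<And>x. x \<in> space M \<Longrightarrow>
    (\<integral>\<^sup>+ y\<in>{y. t \<le> \<delta> x y}. ennreal (\<delta> x y powr (-(1 + s))) \<partial>M) \<le> ennreal V"
    using nn_integral_tail_bound[OF s_pos t] by blast
  define W where "W = C * V + C * t powr (-(1 + s))"
  have W0: "0 \<le> W" using C V by (simp add: W_def)
  have "(\<integral>\<^sup>+ y. ennreal (K \<alpha> x y) * indicator {y. \<delta> x y \<ge> t} y \<partial>M) \<le> ennreal (\<alpha> * W)"
    if a: "0 < \<alpha>" "\<alpha> < 1" and x: "x \<in> space M" for \<alpha> x
  proof -
    note [measurable] = delta_measurable[OF x]
    have "ennreal (K \<alpha> x y) * indicator {y. \<delta> x y \<ge> t} y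
        \<le> ennreal (\<alpha> * C) * (ennreal (\<delta> x y powr (-(1 + s))) * indicator {y. \<delta> x y \<ge> t} y)"
      if y: "y \<in> space M" for y
      using C(2)[OF a(1) harnack[OF a] decay[OF a] x y] a C(1)
      by (auto simp: indicator_def ennreal_mult[symmetric] intro: ennreal_leI)
    then have "(\<integral>\<^sup>+ y. ennreal (K \<alpha> x y) * indicator {y. \<delta> x y \<ge> t} y \<partial>M)
       \<le> (\<integral>\<^sup>+ y. ennreal (\<alpha> * C) * (ennreal (\<delta> x y powr (-(1 + s))) * indicator {y. \<delta> x y \<ge> t} y) \<partial>M)"
      by (intro nn_integral_mono)
    also have "\<dots> = ennreal (\<alpha> * C) * (\<integral>\<^sup>+ y\<in>{y. t \<le> \<delta> x y}. ennreal (\<delta> x y powr (-(1 + s))) \<partial>M)"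
      by (intro nn_integral_cmult) measurable
    also have "\<dots> \<le> ennreal (\<alpha> * C) * ennreal V"
      using V x by (intro mult_left_mono) auto
    also have "\<dots> = ennreal (\<alpha> * (C * V))"
      using a C V by (simp add: ennreal_mult[symmetric] mult_ac)
    also have "\<dots> \<le> ennreal (\<alpha> * W)"
      using a C by (intro ennreal_leI mult_left_mono) (auto simp: W_def)
    finally show ?thesis .
  qed
  moreover have "K \<alpha> x y \<le> \<alpha> * W"
    if a: "0 < \<alpha>" "\<alpha> < 1" and x: "x \<in> space M" and y: "y \<in> space M" "t \<le> \<delta> x y" for \<alpha> x y
  proof -
    have "K \<alpha> x y \<le> \<alpha> * C * \<delta> x y powr (-(1 + s))"
      using C(2)[OF a(1) harnack[OF a] decay[OF a] x y] .
    also have "\<dots> \<le> \<alpha> * C * t powr (-(1 + s))"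
      using a C(1) y t s_pos by (intro mult_left_mono powr_mono2') auto
    also have "\<dots> = \<alpha> * (C * t powr (-(1 + s)))" by (rule mult.assoc)
    also have "\<dots> \<le> \<alpha> * W"
      using a C V by (intro mult_left_mono) (auto simp: W_def)
    finally show ?thesis .
  qed
  ultimately show ?thesis using W0 by blast
qed

lemma concentration:
  assumes "0 < t" "0 < \<epsilon>"
  shows "\<exists>\<alpha>0>0. \<forall>\<alpha>. 0 < \<alpha> \<and> \<alpha> < \<alpha>0 \<and> \<alpha> < 1 \<longrightarrow>
    (\<forall>x\<in>space M. (\<integral>\<^sup>+ y. ennreal (K \<alpha> x y) * indicator {y. \<delta> x y \<ge> t} y \<partial>M) < ennreal \<epsilon>)"
proof -
  obtain W where W: "0 \<le> W" "\<And>\<alpha> x. 0 < \<alpha> \<Longrightarrow> \<alpha> < 1 \<Longrightarrow> x \<in> space M \<Longrightarrow>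
    (\<integral>\<^sup>+ y. ennreal (K \<alpha> x y) * indicator {y. \<delta> x y \<ge> t} y \<partial>M) \<le> ennreal (\<alpha> * W)"
    using far_mass_and_sup_bound[OF assms(1)] by blast
  have "(\<integral>\<^sup>+ y. ennreal (K \<alpha> x y) * indicator {y. \<delta> x y \<ge> t} y \<partial>M) < ennreal \<epsilon>"
    if a: "0 < \<alpha>" "\<alpha> < \<epsilon> / (W + 1)" "\<alpha> < 1" "x \<in> space M" for \<alpha> x
  proof -
    have "\<alpha> * W \<le> \<alpha> * (W + 1)" using a by simp
    also have "\<dots> < \<epsilon>" using a(2) W(1) by (simp add: pos_less_divide_eq)
    finally have "ennreal (\<alpha> * W) < ennreal \<epsilon>" 
      using a(1) W(1) by (subst ennreal_less_iff) auto
    then show ?thesis using W(2)[OF a(1,3,4)] by (rule le_less_trans[rotated])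
  qed
  \<comment> \<open>Dividing by \<open>W + 1\<close> keeps the threshold positive and meaningful
    also when \<open>W\<close> is 0.\<close>
  then show ?thesis
    using assms W(1) by (intro exI[of _ "\<epsilon> / (W + 1)"]) auto
qed

lemma far_integral_and_sup_bound:
  assumes t: "0 < t"
  shows "\<exists>W\<ge>0. \<forall>\<alpha> x. 0 < \<alpha> \<longrightarrow> \<alpha> < 1 \<longrightarrow> x \<in> space M \<longrightarrow>
    (integrable M (\<lambda>y. K \<alpha> x y * indicator {y. t \<le> \<delta> x y} y) \<and>
     (\<integral> y. K \<alpha> x y * indicator {y. t \<le> \<delta> x y} y \<partial>M) \<le> \<alpha> * W) \<and>
    (\<forall>y\<in>space M. t \<le> \<delta> x y \<longrightarrow> K \<alpha> x y \<le> \<alpha> * W)"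
proof -
  obtain W where W: "0 \<le> W" "\<And>\<alpha> x. 0 < \<alpha> \<Longrightarrow> \<alpha> < 1 \<Longrightarrow> x \<in> space M \<Longrightarrow>
      (\<integral>\<^sup>+ y. ennreal (K \<alpha> x y) * indicator {y. \<delta> x y \<ge> t} y \<partial>M) \<le> ennreal (\<alpha> * W)"
      "\<And>\<alpha> x y. 0 < \<alpha> \<Longrightarrow> \<alpha> < 1 \<Longrightarrow> x \<in> space M \<Longrightarrow> y \<in> space M \<Longrightarrow> t \<le> \<delta> x y \<Longrightarrow> K \<alpha> x y \<le> \<alpha> * W"
    using far_mass_and_sup_bound[OF t] by blast
  have "integrable M (\<lambda>y. K \<alpha> x y * indicator {y. t \<le> \<delta> x y} y)
      \<and> (\<integral> y. K \<alpha> x y * indicator {y. t \<le> \<delta> x y} y \<partial>M) \<le> \<alpha> * W"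
    if a: "0 < \<alpha>" "\<alpha> < 1" and x: "x \<in> space M" for \<alpha> x
  proof
    note [measurable] = delta_measurable[OF x] K_measurable[OF a x]
    let ?far = "indicator {y. t \<le> \<delta> x y} :: 'a \<Rightarrow> real"
    show "integrable M (\<lambda>y. K \<alpha> x y * ?far y)"
      using K_has_integral(1)[OF a x] by (rule Bochner_Integration.integrable_bound) (auto simp: indicator_def)
    have "(\<integral>\<^sup>+ y. ennreal (K \<alpha> x y * ?far y) \<partial>M) = (\<integral>\<^sup>+ y. ennreal (K \<alpha> x y) * indicator {y. \<delta> x y \<ge> t} y \<partial>M)"
      by (intro nn_integral_cong) (auto simp: indicator_def)
    also have "\<dots> \<le> ennreal (\<alpha> * W)" using W(2)[OF a x] .
    finally show "(\<integral> y. K \<alpha> x y * ?far y \<partial>M) \<le> \<alpha> * W"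
      using a W(1) K_nonneg[OF a x]
      by (subst integral_eq_nn_integral) (auto simp: enn2real_leI)
  qed
  then show ?thesis using W by blast
qed

lemma eventually_small_parameter: "0 < c \<Longrightarrow> eventually (\<lambda>\<alpha>::real. 0 < \<alpha> \<and> \<alpha> < 1 \<and> \<alpha> < c) (at_right 0)"
  unfolding eventually_at_right_field by (intro exI[of _ "min 1 c"]) auto

text \<open>The shape in which the estimates arise: \<open>e\<close> from the points near
  \<open>x\<close>, \<open>\<alpha> * W\<close> from the far ones. \<open>W\<close> may depend on
  \<open>e\<close>.\<close>

lemma kernel_tendstoI:
  assumes "\<And>e. 0 < e \<Longrightarrow> \<exists>W\<ge>0. \<forall>\<alpha>. 0 < \<alpha> \<longrightarrow> \<alpha> < 1 \<longrightarrow> \<bar>F \<alpha> - l\<bar> \<le> e + \<alpha> * W"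
  shows "(F \<longlongrightarrow> (l::real)) (at_right 0)"
proof (rule tendstoI)
  fix e :: real assume e: "0 < e"
  obtain W where W: "0 \<le> W" "\<And>\<alpha>. 0 < \<alpha> \<Longrightarrow> \<alpha> < 1 \<Longrightarrow> \<bar>F \<alpha> - l\<bar> \<le> e / 2 + \<alpha> * W"
    using assms[of "e / 2"] e by auto
  have "0 < e / (2 * (W + 1))" using e W by simp
  from eventually_small_parameter[OF this] show "\<forall>\<^sub>F \<alpha> in at_right 0. dist (F \<alpha>) l < e"
  proof eventually_elim
    case (elim \<alpha>)
    have "\<alpha> * W \<le> \<alpha> * (W + 1)" using elim by simp
    also have "\<dots> < e / 2" using elim W(1) by (simp add: field_simps)
    finally show ?case using W(2)[of \<alpha>] elim by (simp add: dist_real_def)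
  qed
qed

text \<open>Total mass one turns the error into an integral of
  \<open>K \<alpha> x y * (g y - g x)\<close>. Near \<open>x\<close> continuity makes this small.
  Far away, \<open>\<bar>g x\<bar>\<close> is multiplied by the far mass and
  \<open>\<bar>g y\<bar>\<close> by the far supremum, because \<open>g\<close> is integrable but
  possibly unbounded.\<close>

lemma kernel_tendsto_continuous:
  assumes cont: "continuous_map (delta_topology (space M) \<delta>) euclideanreal g"
    and int: "integrable M g" and x: "x \<in> space M"
  shows "((\<lambda>\<alpha>. kernel_op M (K \<alpha>) g x) \<longlongrightarrow> g x) (at_right 0)"
proof (rule kernel_tendstoI)
  fix e :: real assume e: "0 < e"
  obtain r where r: "0 < r" "\<And>y. y \<in> space M \<Longrightarrow> \<delta> x y < r \<Longrightarrow> \<bar>g y - g x\<bar> < e"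
    using continuous_map_delta_topologyD[OF cont x e] by blast
  obtain W where W: "0 \<le> W" "\<And>\<alpha> x. 0 < \<alpha> \<Longrightarrow> \<alpha> < 1 \<Longrightarrow> x \<in> space M \<Longrightarrow>
      integrable M (\<lambda>y. K \<alpha> x y * indicator {y. r \<le> \<delta> x y} y) \<and>
      (\<integral> y. K \<alpha> x y * indicator {y. r \<le> \<delta> x y} y \<partial>M) \<le> \<alpha> * W"
      "\<And>\<alpha> x y. 0 < \<alpha> \<Longrightarrow> \<alpha> < 1 \<Longrightarrow> x \<in> space M \<Longrightarrow> y \<in> space M \<Longrightarrow> r \<le> \<delta> x y \<Longrightarrow> K \<alpha> x y \<le> \<alpha> * W"
    using far_integral_and_sup_bound[OF r(1)] by blast
  note [measurable] = delta_measurable[OF x] borel_measurable_integrable[OF int]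
  define G where "G = (\<integral> y. \<bar>g y\<bar> \<partial>M)"
  have "\<bar>kernel_op M (K \<alpha>) g x - g x\<bar> \<le> e + \<alpha> * (W * (\<bar>g x\<bar> + G))"
    if a: "0 < \<alpha>" "\<alpha> < 1" for \<alpha>
  proof -
    note [measurable] = K_measurable[OF a x]
    note Kint = K_has_integral[OF a x]
    let ?far = "indicator {y. \<delta> x y \<ge> r} :: 'a \<Rightarrow> real"
    note far_int = W(2)[OF a x, THEN conjunct1] and far_le = W(2)[OF a x, THEN conjunct2]
    have bound: "K \<alpha> x y * \<bar>g y - g x\<bar> \<le> e * K \<alpha> x y + \<bar>g x\<bar> * (K \<alpha> x y * ?far y) + \<alpha> * W * \<bar>g y\<bar>"
      if y: "y \<in> space M" for y
    proof (cases "\<delta> x y < r")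
      case True
      have "K \<alpha> x y * \<bar>g y - g x\<bar> \<le> K \<alpha> x y * e"
        using r(2)[OF y True] K_nonneg[OF a x y] by (intro mult_left_mono) auto
      then show ?thesis
        using True a W(1) by (simp add: mult.commute add_increasing2)
    next
      case False
      have "K \<alpha> x y * \<bar>g y - g x\<bar> \<le> K \<alpha> x y * (\<bar>g x\<bar> + \<bar>g y\<bar>)"
        using K_nonneg[OF a x y] by (intro mult_left_mono) auto
      also have "\<dots> = \<bar>g x\<bar> * K \<alpha> x y + K \<alpha> x y * \<bar>g y\<bar>" by (simp add: algebra_simps)
      also have "\<dots> \<le> \<bar>g x\<bar> * K \<alpha> x y + \<alpha> * W * \<bar>g y\<bar>"
        using W(3)[OF a x y] False by (intro add_left_mono mult_right_mono) auto
      finally show ?thesis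
        using False mult_nonneg_nonneg[OF less_imp_le[OF e] K_nonneg[OF a x y]] by simp
    qed
    let ?b = "\<lambda>y. e * K \<alpha> x y + \<bar>g x\<bar> * (K \<alpha> x y * ?far y) + \<alpha> * W * \<bar>g y\<bar>"
    have bint: "integrable M ?b"
      using Kint(1) far_int int by (intro Bochner_Integration.integrable_add integrable_mult_right integrable_abs)
    have dint: "integrable M (\<lambda>y. K \<alpha> x y * (g y - g x))"
      using bint
    proof (rule Bochner_Integration.integrable_bound)
      show "AE y in M. norm (K \<alpha> x y * (g y - g x)) \<le> norm (?b y)"
        using AE_space
      proof eventually_elim
        case (elim y)
        show ?case using bound[OF elim] K_nonneg[OF a x elim] by (simp add: abs_mult)
      qed
    qed measurable
    have "integrable M (\<lambda>y. K \<alpha> x y * (g y - g x) + g x * K \<alpha> x y)"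
      using dint Kint(1) by (intro Bochner_Integration.integrable_add integrable_mult_right)
    then have "kernel_op M (K \<alpha>) g x = (\<integral> y. K \<alpha> x y * (g y - g x) + g x * K \<alpha> x y \<partial>M)"
      unfolding kernel_op_def by (intro Bochner_Integration.integral_cong) (auto simp: algebra_simps)
    also have "\<dots> = (\<integral> y. K \<alpha> x y * (g y - g x) \<partial>M) + g x"
      using dint Kint by simp
    finally have "\<bar>kernel_op M (K \<alpha>) g x - g x\<bar> = \<bar>\<integral> y. K \<alpha> x y * (g y - g x) \<partial>M\<bar>" by simp
    also have "\<dots> \<le> (\<integral> y. ?b y \<partial>M)"
      using dint bint
    proof (rule abs_integral_le_integral_AE)
      show "AE y in M. \<bar>K \<alpha> x y * (g y - g x)\<bar> \<le> ?b y"
        using bound K_nonneg[OF a x] by (intro AE_I2) (simp add: abs_mult)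
    qed
    also have "\<dots> = e + \<bar>g x\<bar> * (\<integral> y. K \<alpha> x y * ?far y \<partial>M) + \<alpha> * W * G"
      using Kint far_int int by (simp add: G_def)
    also have "\<dots> \<le> e + \<bar>g x\<bar> * (\<alpha> * W) + \<alpha> * W * G"
      using far_le by (intro add_right_mono add_left_mono mult_left_mono) auto
    finally show ?thesis by (simp add: algebra_simps)
  qed
  moreover have "0 \<le> W * (\<bar>g x\<bar> + G)"
    using W(1) by (simp add: G_def)
  ultimately show "\<exists>W\<ge>0. \<forall>\<alpha>. 0 < \<alpha> \<longrightarrow> \<alpha> < 1 \<longrightarrow> \<bar>kernel_op M (K \<alpha>) g x - g x\<bar> \<le> e + \<alpha> * W"
    by blast
qed

section \<open>Bounds for the maximal operator of the family\<close>

lemma nn_integral_K_le_hlabs: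
  assumes a: "0 < \<alpha>" "\<alpha> < 1" and x: "x \<in> space M" and [measurable]: "f \<in> borel_measurable M"
  shows "(\<integral>\<^sup>+ y. ennreal (norm (K \<alpha> x y * f y)) \<partial>M) \<le> ennreal CK * hlabs f x"
proof -
  have "(\<integral>\<^sup>+ y. ennreal (norm (K \<alpha> x y * f y)) \<partial>M) = (\<integral>\<^sup>+ y. ennreal (K \<alpha> x y) * ennreal \<bar>f y\<bar> \<partial>M)"
    using K_nonneg[OF a x] by (intro nn_integral_cong) (simp add: abs_mult ennreal_mult)
  also have "\<dots> \<le> ennreal CK * hlabs f x"
    unfolding CK_def using kernel_le_hlmax[OF markov[OF a] harnack[OF a] x] by simp
  finally show ?thesis .
qed

text \<open>Guards the later use of additivity: the Bochner integral is 0 on functions that are not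
  integrable, so splitting \<open>f\<close> under the kernel requires this.\<close>

lemma K_mult_integrable:
  assumes a: "0 < \<alpha>" "\<alpha> < 1" and x: "x \<in> space M" and f [measurable]: "f \<in> borel_measurable M"
    and fin: "hlabs f x < \<infinity>"
  shows "integrable M (\<lambda>y. K \<alpha> x y * f y)"
proof -
  note [measurable] = K_measurable[OF a x]
  have "(\<integral>\<^sup>+ y. ennreal (norm (K \<alpha> x y * f y)) \<partial>M) \<le> ennreal CK * hlabs f x"
    by (rule nn_integral_K_le_hlabs[OF a x f])
  also have "\<dots> < \<infinity>"
    using fin by (simp add: ennreal_mult_less_top)
  finally show ?thesis
    by (intro integrableI_bounded) auto
qed

text \<open>If the integrand is not integrable, \<open>kernel_op\<close> is 0 by convention and the
  bound is trivial.\<close>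

lemma kernel_op_le_hlabs:
  assumes a: "0 < \<alpha>" "\<alpha> < 1" and x: "x \<in> space M" and f: "f \<in> borel_measurable M"
  shows "ennreal \<bar>kernel_op M (K \<alpha>) f x\<bar> \<le> ennreal CK * hlabs f x"
proof (cases "integrable M (\<lambda>y. K \<alpha> x y * f y)")
  case True
  then show ?thesis
    using order_trans[OF integral_norm_bound_ennreal[OF True] nn_integral_K_le_hlabs[OF a x f]]
    unfolding kernel_op_def by simp
next
  case False
  then show ?thesis
    unfolding kernel_op_def by (simp add: not_integrable_integral_eq)
qed

lemma maximal_op_le_hlabs:
  assumes "x \<in> space M" "f \<in> borel_measurable M"
  shows "maximal_op M K f x \<le> ennreal CK * hlabs f x"
  unfolding maximal_op_def using assms by (intro SUP_least kernel_op_le_hlabs) auto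

lemma maximal_op_weak_type:
  "\<exists>C. \<forall>f. f \<in> borel_measurable M \<and> integrable M f \<longrightarrow>
     (\<forall>t>0. \<exists>A\<in>sets M. {x \<in> space M. maximal_op M K f x > ennreal t} \<subseteq> A \<and>
       emeasure M A \<le> ennreal (C / t) * (\<integral>\<^sup>+ x. ennreal \<bar>f x\<bar> \<partial>M))"
proof (intro exI[of _ "c2 * vitali * CK"] allI impI)
  fix f :: "'a \<Rightarrow> real" and t :: real assume f: "f \<in> borel_measurable M \<and> integrable M f" and t: "0 < t"
  note [measurable] = conjunct1[OF f]
  let ?A = "{x \<in> space M. ennreal (t / CK) < hlabs f x}"
  have "{x \<in> space M. maximal_op M K f x > ennreal t} \<subseteq> ?A"
  proof
    fix x assume "x \<in> {x \<in> space M. maximal_op M K f x > ennreal t}"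
    then have x: "x \<in> space M" "ennreal t < ennreal CK * hlabs f x"
      using maximal_op_le_hlabs f by (auto intro: less_le_trans)
    have "ennreal (t / CK) < hlabs f x"
    proof (rule ccontr)
      assume "\<not> ennreal (t / CK) < hlabs f x"
      then have "ennreal CK * hlabs f x \<le> ennreal CK * ennreal (t / CK)"
        by (intro mult_left_mono) auto
      also have "\<dots> = ennreal t"
        using CK_pos t by (simp add: ennreal_mult[symmetric])
      finally show False using x by simp
    qed
    then show "x \<in> ?A" using x by simp
  qed
  moreover have "emeasure M ?A \<le> ennreal (c2 * vitali / (t / CK)) * (\<integral>\<^sup>+ x. ennreal \<bar>f x\<bar> \<partial>M)"
    using t CK_pos by (intro hlmax_weak_type) auto
  ultimately show "\<exists>A\<in>sets M. {x \<in> space M. maximal_op M K f x > ennreal t} \<subseteq> A \<and>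
       emeasure M A \<le> ennreal (c2 * vitali * CK / t) * (\<integral>\<^sup>+ x. ennreal \<bar>f x\<bar> \<partial>M)"
    by (intro bexI[of _ ?A]) (auto simp: field_simps)
qed

end

context approximate_identity
begin

lemma maximal_op_strong_type:
  assumes p: "1 < p"
  shows "\<exists>C. \<forall>f. in_Lp M p f \<longrightarrow>
    (\<exists>g. g \<in> borel_measurable M \<and> (AE x in M. maximal_op M K f x \<le> ennreal (g x)) \<and> in_Lp M p g \<and>
      (\<integral> x. \<bar>g x\<bar> powr p \<partial>M) \<le> C powr p * (\<integral> x. \<bar>f x\<bar> powr p \<partial>M))"
proof -
  define A where "A = p * (2 * c2 * vitali) * (2 * c2) powr (p - 1) / (p - 1)"
  have A: "0 < A"
    using p c2_pos vitali_pos by (simp add: A_def)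
  \<comment> \<open>The \<open>p\<close>-th root of the interpolation constant, because the claim is
    stated with \<open>C powr p\<close>.\<close>
  define C where "C = CK * A powr (1 / p)"
  have Cp: "C powr p = CK powr p * A"
    using A CK_pos p by (simp add: C_def powr_mult powr_powr)
  have "\<exists>g. g \<in> borel_measurable M \<and> (AE x in M. maximal_op M K f x \<le> ennreal (g x)) \<and> in_Lp M p g \<and>
      (\<integral> x. \<bar>g x\<bar> powr p \<partial>M) \<le> C powr p * (\<integral> x. \<bar>f x\<bar> powr p \<partial>M)"
    if f: "in_Lp M p f" for f
  proof (intro exI conjI)
    have fm [measurable]: "f \<in> borel_measurable M" using f by (simp add: in_Lp_def)
    define g where "g x = CK * enn2real (hlabs f x)" for x
    show gm [measurable]: "g \<in> borel_measurable M" unfolding g_def[abs_def] by measurable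
    have "AE x in M. hlabs f x < \<infinity>"
      using p by (intro hlabs_finite_AE_Lp[OF f]) simp
    then show "AE x in M. maximal_op M K f x \<le> ennreal (g x)"
      using AE_space
    proof eventually_elim
      case (elim x)
      have "ennreal CK * hlabs f x = ennreal (g x)"
        using elim CK_pos by (simp add: g_def ennreal_mult)
      then show ?case using maximal_op_le_hlabs[OF elim(2) fm] by simp
    qed
    have "(\<integral>\<^sup>+ x. ennreal (\<bar>g x\<bar> powr p) \<partial>M) = (\<integral>\<^sup>+ x. ennreal (CK powr p) * ennreal (enn2real (hlabs f x) powr p) \<partial>M)"
      using CK_pos by (intro nn_integral_cong) (simp add: g_def powr_mult ennreal_mult)
    also have "\<dots> = ennreal (CK powr p) * (\<integral>\<^sup>+ x. ennreal (enn2real (hlabs f x) powr p) \<partial>M)"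
      by (rule nn_integral_cmult) measurable
    also have "\<dots> \<le> ennreal (CK powr p) * (ennreal A * (\<integral>\<^sup>+ x. ennreal (\<bar>f x\<bar> powr p) \<partial>M))"
      unfolding A_def using p by (intro mult_left_mono hlabs_strong_type) auto
    also have "\<dots> = ennreal (C powr p * (\<integral> x. \<bar>f x\<bar> powr p \<partial>M))"
      unfolding in_Lp_nn_integral[OF f] Cp using A by (simp add: ennreal_mult mult.assoc)
    finally have le: "(\<integral>\<^sup>+ x. ennreal (\<bar>g x\<bar> powr p) \<partial>M) \<le> ennreal (C powr p * (\<integral> x. \<bar>f x\<bar> powr p \<partial>M))" .
    have "integrable M (\<lambda>x. \<bar>g x\<bar> powr p)"
      using le_less_trans[OF le, of \<infinity>] by (intro integrableI_bounded) auto
    then show "in_Lp M p g"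
      using gm by (simp add: in_Lp_def)
    show "(\<integral> x. \<bar>g x\<bar> powr p \<partial>M) \<le> C powr p * (\<integral> x. \<bar>f x\<bar> powr p \<partial>M)"
      using le by (subst integral_eq_nn_integral) (auto simp: enn2real_leI)
  qed
  then show ?thesis by blast
qed

lemma K_mult_bounded:
  assumes a: "0 < \<alpha>" "\<alpha> < 1" and x: "x \<in> space M" and [measurable]: "f \<in> borel_measurable M"
    and b: "AE y in M. \<bar>f y\<bar> \<le> b"
  shows "integrable M (\<lambda>y. K \<alpha> x y * f y)" "\<bar>kernel_op M (K \<alpha>) f x\<bar> \<le> b"
proof -
  note [measurable] = K_measurable[OF a x]
  have le: "AE y in M. \<bar>K \<alpha> x y * f y\<bar> \<le> K \<alpha> x y * b"
    using b AE_space
    by eventually_elim (auto simp: abs_mult K_nonneg[OF a x] intro: mult_left_mono)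
  have bi: "integrable M (\<lambda>y. K \<alpha> x y * b)"
    using K_has_integral[OF a x] by (intro integrable_mult_left)
  show fi: "integrable M (\<lambda>y. K \<alpha> x y * f y)"
    using bi by (rule Bochner_Integration.integrable_bound) (use le in auto)
  show "\<bar>kernel_op M (K \<alpha>) f x\<bar> \<le> b"
    using abs_integral_le_integral_AE[OF fi bi le] K_has_integral[OF a x]
    by (simp add: kernel_op_def)
qed

lemma maximal_op_bounded:
  assumes f: "f \<in> borel_measurable M" and b: "AE y in M. \<bar>f y\<bar> \<le> b"
  shows "AE x in M. maximal_op M K f x \<le> ennreal b"
  unfolding maximal_op_def
  by (intro AE_I2 SUP_least ennreal_leI K_mult_bounded(2)[OF _ _ _ f b]) auto

section \<open>Almost everywhere convergence\<close>

lemma kernel_op_add: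
  assumes "integrable M (\<lambda>y. k x y * f y)" "integrable M (\<lambda>y. k x y * g y)"
    and "\<And>y. y \<in> space M \<Longrightarrow> h y = f y + g y"
  shows "kernel_op M k h x = kernel_op M k f x + kernel_op M k g x"
proof -
  have "kernel_op M k h x = (\<integral> y. k x y * f y + k x y * g y \<partial>M)"
    unfolding kernel_op_def using assms(3)
    by (intro Bochner_Integration.integral_cong) (auto simp: algebra_simps)
  then show ?thesis using assms by (simp add: kernel_op_def)
qed

lemma kernel_op_tendsto_add:
  assumes f: "((\<lambda>\<alpha>. kernel_op M (K \<alpha>) f x) \<longlongrightarrow> a) (at_right 0)"
    and g: "((\<lambda>\<alpha>. kernel_op M (K \<alpha>) g x) \<longlongrightarrow> b) (at_right 0)"
    and fi: "\<And>\<alpha>. 0 < \<alpha> \<Longrightarrow> \<alpha> < 1 \<Longrightarrow> integrable M (\<lambda>y. K \<alpha> x y * f y)"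
    and gi: "\<And>\<alpha>. 0 < \<alpha> \<Longrightarrow> \<alpha> < 1 \<Longrightarrow> integrable M (\<lambda>y. K \<alpha> x y * g y)"
    and h: "\<And>y. y \<in> space M \<Longrightarrow> h y = f y + g y"
  shows "((\<lambda>\<alpha>. kernel_op M (K \<alpha>) h x) \<longlongrightarrow> a + b) (at_right 0)"
proof (rule Lim_transform_eventually[OF tendsto_add[OF f g]])
  show "\<forall>\<^sub>F \<alpha> in at_right 0. kernel_op M (K \<alpha>) f x + kernel_op M (K \<alpha>) g x = kernel_op M (K \<alpha>) h x"
    using eventually_small_parameter[of 1, simplified]
    by eventually_elim (use h in \<open>auto intro!: kernel_op_add[symmetric] fi gi\<close>)
qed

text \<open>Writing \<open>f = g n + \<phi> n\<close> with \<open>g n\<close> continuous, the error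
  is controlled by \<open>CK * hlabs (\<phi> n) x + \<bar>\<phi> n x\<bar>\<close>, uniformly in the
  parameter, plus an error for \<open>g n\<close> that vanishes in the limit. It remains to make the
  first part small for some \<open>n\<close>, at almost every \<open>x\<close>.\<close>

lemma AE_tendsto_integrable:
  assumes dense: "continuous_dense_L1 M \<delta>" and f: "integrable M f"
  shows "AE x in M. ((\<lambda>\<alpha>. kernel_op M (K \<alpha>) f x) \<longlongrightarrow> f x) (at_right 0)"
proof -
  note fm [measurable] = borel_measurable_integrable[OF f]
  have "\<forall>n::nat. \<exists>g. continuous_map (delta_topology (space M) \<delta>) euclideanreal g \<and>
      integrable M g \<and> (\<integral>\<^sup>+ x. ennreal \<bar>f x - g x\<bar> \<partial>M) < ennreal (1 / real (Suc n))"
  proof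
    fix n :: nat
    have "0 < 1 / real (Suc n)" by simp
    then show "\<exists>g. continuous_map (delta_topology (space M) \<delta>) euclideanreal g \<and>
      integrable M g \<and> (\<integral>\<^sup>+ x. ennreal \<bar>f x - g x\<bar> \<partial>M) < ennreal (1 / real (Suc n))"
      using dense f fm unfolding continuous_dense_L1_def by meson
  qed
  from choice[OF this] obtain g where
    "\<forall>n::nat. continuous_map (delta_topology (space M) \<delta>) euclideanreal (g n) \<and>
      integrable M (g n) \<and> (\<integral>\<^sup>+ x. ennreal \<bar>f x - g n x\<bar> \<partial>M) < ennreal (1 / real (Suc n))" ..
  then have g: "\<And>n. continuous_map (delta_topology (space M) \<delta>) euclideanreal (g n)"
    "\<And>n. integrable M (g n)" "\<And>n::nat. (\<integral>\<^sup>+ x. ennreal \<bar>f x - g n x\<bar> \<partial>M) < ennreal (1 / real (Suc n))"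
    by (simp_all only:)
  note gm [measurable] = borel_measurable_integrable[OF g(2)]
  define \<phi> where "\<phi> n x = f x - g n x" for n x
  have \<phi>m [measurable]: "\<phi> n \<in> borel_measurable M" for n unfolding \<phi>_def[abs_def] by measurable
  \<comment> \<open>A countable infimum, hence measurable, in contrast to the oscillation over all
    parameters. It vanishes almost everywhere: for each \<open>t\<close> and every \<open>n\<close>
    the set where \<open>F\<close> exceeds \<open>t\<close> has measure O(1 / n).\<close>
  define F where "F x = (INF n. hlabs (\<phi> n) x + ennreal \<bar>\<phi> n x\<bar>)" for x
  have [measurable]: "F \<in> borel_measurable M" unfolding F_def[abs_def] by measurable
  have "AE x in M. F x \<le> ennreal (1 / real (Suc m))" for m
  proof -
    define t where "t = 1 / real (Suc m)"
    have t: "0 < t" by (simp add: t_def)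
    \<comment> \<open>If the sum exceeds \<open>t\<close>, one summand exceeds \<open>t / 2\<close>:
      the first constant is the weak type bound for \<open>hlabs (\<phi> n)\<close>, the second
      Markov's inequality for \<open>\<phi> n\<close>.\<close>
    define C where "C = c2 * vitali / (t / 2) + 2 / t"
    have C0: "0 \<le> C" using t c2_pos vitali_pos by (simp add: C_def)
    have "emeasure M {x \<in> space M. ennreal t < F x} = 0"
    proof (rule ennreal_eq_0_if_le_harmonic[of 1 _ C])
      fix n :: nat
      let ?X = "{x \<in> space M. ennreal (t / 2) < hlabs (\<phi> n) x}"
      let ?Y = "{x \<in> space M. 1 \<le> ennreal (2 / t) * ennreal \<bar>\<phi> n x\<bar>}"
      have "{x \<in> space M. ennreal t < F x} \<subseteq> ?X \<union> ?Y"
      proof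
        fix x assume x: "x \<in> {x \<in> space M. ennreal t < F x}"
        have "F x \<le> hlabs (\<phi> n) x + ennreal \<bar>\<phi> n x\<bar>"
          unfolding F_def by (rule INF_lower) simp
        then have less: "ennreal t < hlabs (\<phi> n) x + ennreal \<bar>\<phi> n x\<bar>"
          using x by (auto intro: less_le_trans)
        show "x \<in> ?X \<union> ?Y"
        proof (rule ccontr)
          assume n: "x \<notin> ?X \<union> ?Y"
          then have h: "hlabs (\<phi> n) x \<le> ennreal (t / 2)" using x by (auto simp: not_less)
          have "\<bar>\<phi> n x\<bar> \<le> t / 2"
          proof (rule ccontr)
            assume "\<not> \<bar>\<phi> n x\<bar> \<le> t / 2"
            then have "1 \<le> 2 / t * \<bar>\<phi> n x\<bar>" using t by (simp add: field_simps)
            then have "1 \<le> ennreal (2 / t * \<bar>\<phi> n x\<bar>)" by simp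
            also have "\<dots> = ennreal (2 / t) * ennreal \<bar>\<phi> n x\<bar>"
              using t by (intro ennreal_mult) auto
            finally show False using n x by auto
          qed
          then have "hlabs (\<phi> n) x + ennreal \<bar>\<phi> n x\<bar> \<le> ennreal (t / 2) + ennreal (t / 2)"
            using h by (intro add_mono ennreal_leI)
          also have "\<dots> = ennreal t" using t by (simp add: ennreal_plus[symmetric] del: ennreal_plus)
          finally show False using less by (simp add: leD)
        qed
      qed
      then have "emeasure M {x \<in> space M. ennreal t < F x} \<le> emeasure M (?X \<union> ?Y)"
        by (intro emeasure_mono) auto
      also have "\<dots> \<le> emeasure M ?X + emeasure M ?Y"
        by (intro emeasure_subadditive) auto
      also have "\<dots> \<le> ennreal (c2 * vitali / (t / 2)) * (\<integral>\<^sup>+ y. ennreal \<bar>\<phi> n y\<bar> \<partial>M)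
          + ennreal (2 / t) * (\<integral>\<^sup>+ y. ennreal \<bar>\<phi> n y\<bar> * indicator (space M) y \<partial>M)"
        using t by (intro add_mono hlmax_weak_type nn_integral_Markov_inequality) auto
      also have "(\<integral>\<^sup>+ y. ennreal \<bar>\<phi> n y\<bar> * indicator (space M) y \<partial>M) = (\<integral>\<^sup>+ y. ennreal \<bar>\<phi> n y\<bar> \<partial>M)"
        by (intro nn_integral_cong) auto
      also have "ennreal (c2 * vitali / (t / 2)) * (\<integral>\<^sup>+ y. ennreal \<bar>\<phi> n y\<bar> \<partial>M)
          + ennreal (2 / t) * (\<integral>\<^sup>+ y. ennreal \<bar>\<phi> n y\<bar> \<partial>M) = ennreal C * (\<integral>\<^sup>+ y. ennreal \<bar>\<phi> n y\<bar> \<partial>M)"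
        unfolding C_def using t c2_pos vitali_pos
        by (subst ennreal_plus) (auto simp: distrib_right)
      also have "\<dots> \<le> ennreal C * ennreal (1 / real (Suc n))"
        using g(3)[of n] by (intro mult_left_mono) (auto simp: \<phi>_def less_imp_le)
      also have "\<dots> = ennreal (C / real (Suc n)) * 1"
        using C0 by (simp add: ennreal_mult[symmetric] del: of_nat_Suc)
      finally show "emeasure M {x \<in> space M. ennreal t < F x} \<le> ennreal (C / real (Suc n)) * 1" .
    qed simp
    then have "AE x in M. \<not> ennreal t < F x"
      by (subst AE_iff_measurable[OF _ refl]) auto
    then show ?thesis unfolding t_def by (simp add: not_less)
  qed
  then have "AE x in M. \<forall>m. F x \<le> ennreal (1 / real (Suc m))"
    by (simp add: AE_all_countable del: of_nat_Suc)
  moreover have "AE x in M. \<forall>n. hlabs (g n) x < \<infinity>"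
    using hlabs_finite_AE[OF g(2)] by (simp add: AE_all_countable)
  moreover have "AE x in M. \<forall>n. hlabs (\<phi> n) x < \<infinity>"
    using f g(2) unfolding AE_all_countable by (intro allI hlabs_finite_AE) (auto simp: \<phi>_def[abs_def])
  ultimately show ?thesis
    using AE_space
  proof eventually_elim
    case (elim x)
    show ?case
    proof (rule tendstoI)
      fix e :: real assume e: "0 < e"
      \<comment> \<open>The kernel applied to \<open>\<phi> n\<close> costs
        \<open>CK * \<eta>\<close> and the value \<open>\<phi> n x\<close> costs
        \<open>\<eta>\<close>, together \<open>e / 2\<close>; the other half is reserved for
        \<open>g n\<close>.\<close>
      define \<eta> where "\<eta> = e / (2 * (CK + 1))"
      have \<eta>: "0 < \<eta>" using e CK_pos by (simp add: \<eta>_def)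
      obtain m where m: "inverse (real (Suc m)) < \<eta>" using reals_Archimedean[OF \<eta>] by blast
      have "F x \<le> ennreal (1 / real (Suc m))" using elim by blast
      also have "\<dots> < ennreal \<eta>" using m \<eta> by (intro ennreal_lessI) (auto simp: inverse_eq_divide)
      finally obtain n where n: "hlabs (\<phi> n) x + ennreal \<bar>\<phi> n x\<bar> < ennreal \<eta>"
        unfolding F_def by (auto simp: INF_less_iff)
      have "hlabs (\<phi> n) x \<le> hlabs (\<phi> n) x + ennreal \<bar>\<phi> n x\<bar>" by simp
      also note less_imp_le[OF n]
      finally have h\<eta>: "hlabs (\<phi> n) x \<le> ennreal \<eta>" .
      have "ennreal \<bar>\<phi> n x\<bar> \<le> hlabs (\<phi> n) x + ennreal \<bar>\<phi> n x\<bar>" by simp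
      also note n
      finally have "ennreal \<bar>\<phi> n x\<bar> < ennreal \<eta>" .
      then have \<phi>x: "\<bar>\<phi> n x\<bar> < \<eta>" by (simp add: ennreal_less_iff)
      have K\<phi>: "\<bar>kernel_op M (K \<alpha>) (\<phi> n) x\<bar> \<le> CK * \<eta>" if a: "0 < \<alpha>" "\<alpha> < 1" for \<alpha>
      proof -
        have "ennreal \<bar>kernel_op M (K \<alpha>) (\<phi> n) x\<bar> \<le> ennreal CK * hlabs (\<phi> n) x"
          using elim a by (intro kernel_op_le_hlabs) auto
        also have "\<dots> \<le> ennreal CK * ennreal \<eta>" using h\<eta> by (intro mult_left_mono) auto
        also have "\<dots> = ennreal (CK * \<eta>)" using CK_pos \<eta> by (simp add: ennreal_mult)
        finally show ?thesis using CK_pos \<eta> by (simp add: ennreal_le_iff)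
      qed
      have "((\<lambda>\<alpha>. kernel_op M (K \<alpha>) (g n) x) \<longlongrightarrow> g n x) (at_right 0)"
        using elim g by (intro kernel_tendsto_continuous) auto
      then have "\<forall>\<^sub>F \<alpha> in at_right 0. dist (kernel_op M (K \<alpha>) (g n) x) (g n x) < e / 2"
        using e by (intro tendstoD) auto
      then show "\<forall>\<^sub>F \<alpha> in at_right 0. dist (kernel_op M (K \<alpha>) f x) (f x) < e"
        using eventually_small_parameter[of 1, simplified]
      proof eventually_elim
        case (elim \<alpha>)
        then have a: "0 < \<alpha>" "\<alpha> < 1" by auto
        have x: "x \<in> space M" and fin: "hlabs (g n) x < \<infinity>" "hlabs (\<phi> n) x < \<infinity>"
          using \<open>x \<in> space M\<close> \<open>\<forall>n. hlabs (g n) x < \<infinity>\<close> \<open>\<forall>n. hlabs (\<phi> n) x < \<infinity>\<close> by auto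
        have "kernel_op M (K \<alpha>) f x = kernel_op M (K \<alpha>) (\<phi> n) x + kernel_op M (K \<alpha>) (g n) x"
          using fin by (intro kernel_op_add K_mult_integrable[OF a x]) (auto simp: \<phi>_def)
        then have "\<bar>kernel_op M (K \<alpha>) f x - f x\<bar> \<le>
            \<bar>kernel_op M (K \<alpha>) (\<phi> n) x\<bar> + \<bar>kernel_op M (K \<alpha>) (g n) x - g n x\<bar> + \<bar>\<phi> n x\<bar>"
          by (simp add: \<phi>_def)
        also have "\<dots> < CK * \<eta> + e / 2 + \<eta>"
          using K\<phi>[OF a] elim(1) \<phi>x by (simp add: dist_real_def)
        also have "\<dots> = (CK + 1) * \<eta> + e / 2" by (simp add: algebra_simps)
        also have "(CK + 1) * \<eta> = e / 2" using CK_pos by (simp add: \<eta>_def field_simps)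
        finally show ?case by (simp add: dist_real_def)
      qed
    qed
  qed
qed

text \<open>Restricted to a ball, which has finite measure, a bounded function is integrable. The
  part outside a sufficiently large ball keeps distance at least 1 from \<open>x\<close> and sees
  only the far mass of the kernel, which is O(\<alpha>).\<close>

lemma AE_tendsto_bounded:
  assumes dense: "continuous_dense_L1 M \<delta>" and f [measurable]: "f \<in> borel_measurable M"
    and b: "AE y in M. \<bar>f y\<bar> \<le> b"
  shows "AE x in M. ((\<lambda>\<alpha>. kernel_op M (K \<alpha>) f x) \<longlongrightarrow> f x) (at_right 0)"
proof -
  obtain x0 where x0: "x0 \<in> space M" using space_nonempty by blast
  define f1 where "f1 n y = f y * indicator (B x0 (real n)) y" for n :: nat and y
  define f2 where "f2 n y = f y * (1 - indicator (B x0 (real n)) y)" for n :: nat and y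
  note [measurable] = B_sets[OF x0]
  have f1m [measurable]: "f1 n \<in> borel_measurable M" and f2m [measurable]: "f2 n \<in> borel_measurable M" for n
    unfolding f1_def[abs_def] f2_def[abs_def] by measurable
  have "integrable M (f1 n)" for n
  proof (rule Bochner_Integration.integrable_bound)
    show "integrable M (\<lambda>y. b * indicator (B x0 (real n)) y)"
      using emeasure_B_finite[OF x0, of "real n"] by (intro integrable_mult_right integrable_real_indicator) auto
    show "AE y in M. norm (f1 n y) \<le> norm (b * indicator (B x0 (real n)) y)"
      using b by eventually_elim (auto simp: f1_def indicator_def)
  qed measurable
  \<comment> \<open>All cut-offs are treated off a single null set, because the \<open>n\<close>
    used below depends on \<open>x\<close>.\<close>
  then have "AE x in M. \<forall>n. ((\<lambda>\<alpha>. kernel_op M (K \<alpha>) (f1 n) x) \<longlongrightarrow> f1 n x) (at_right 0)"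
    using AE_tendsto_integrable[OF dense] by (simp add: AE_all_countable)
  then show ?thesis
    using AE_space
  proof eventually_elim
    case (elim x)
    have x: "x \<in> space M" by (rule elim(2))
    \<comment> \<open>By the quasi-triangle inequality, every point at distance below 1 from
      \<open>x\<close> then lies in \<open>B x0 (real n)\<close>.\<close>
    obtain n :: nat where n: "\<tau> * (\<delta> x0 x + 1) < real n" using reals_Archimedean2 by blast
    have "\<delta> x0 x + 1 \<le> \<tau> * (\<delta> x0 x + 1)"
      using mult_right_mono[OF tau_ge_1, of "\<delta> x0 x + 1"] nonneg[OF x0 x] by simp
    then have xB: "x \<in> B x0 (real n)" using n x by (simp add: mem_B_iff)
    have far: "1 \<le> \<delta> x y" if y: "y \<in> space M" "y \<notin> B x0 (real n)" for y
    proof (rule ccontr)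
      assume "\<not> 1 \<le> \<delta> x y"
      then have "\<tau> * (\<delta> x0 x + \<delta> x y) \<le> \<tau> * (\<delta> x0 x + 1)"
        using tau_pos by (intro mult_left_mono) auto
      then show False
        using triangle[OF x0 x y(1)] n y by (simp add: mem_B_iff)
    qed
    have ae1: "AE y in M. \<bar>f1 n y\<bar> \<le> \<bar>b\<bar>" and ae2: "AE y in M. \<bar>f2 n y\<bar> \<le> \<bar>b\<bar>"
      using b by (eventually_elim, auto simp: f1_def f2_def indicator_def)+
    note int1 = K_mult_bounded(1)[OF _ _ x f1m ae1] and int2 = K_mult_bounded(1)[OF _ _ x f2m ae2]
    obtain W where W: "0 \<le> W" "\<And>\<alpha> x. 0 < \<alpha> \<Longrightarrow> \<alpha> < 1 \<Longrightarrow> x \<in> space M \<Longrightarrow>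
      integrable M (\<lambda>y. K \<alpha> x y * indicator {y. 1 \<le> \<delta> x y} y) \<and>
      (\<integral> y. K \<alpha> x y * indicator {y. 1 \<le> \<delta> x y} y \<partial>M) \<le> \<alpha> * W"
      using far_integral_and_sup_bound[of 1] by auto
    have "((\<lambda>\<alpha>. kernel_op M (K \<alpha>) (f2 n) x) \<longlongrightarrow> 0) (at_right 0)"
    proof (rule kernel_tendstoI)
      fix e :: real assume e: "0 < e"
      have "\<bar>kernel_op M (K \<alpha>) (f2 n) x - 0\<bar> \<le> e + \<alpha> * (\<bar>b\<bar> * W)" if a: "0 < \<alpha>" "\<alpha> < 1" for \<alpha>
      proof -
        let ?u = "\<lambda>y. \<bar>b\<bar> * (K \<alpha> x y * indicator {y. 1 \<le> \<delta> x y} y)"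
        have "AE y in M. \<bar>K \<alpha> x y * f2 n y\<bar> \<le> ?u y"
          using b AE_space
        proof eventually_elim
          case (elim y)
          have "K \<alpha> x y * \<bar>f y\<bar> \<le> K \<alpha> x y * \<bar>b\<bar>"
            using elim K_nonneg[OF a x] by (intro mult_left_mono) auto
          then show ?case
            using elim far[of y] K_nonneg[OF a x, of y]
            by (auto simp: f2_def indicator_def abs_mult mult.commute)
        qed
        then have "\<bar>\<integral> y. K \<alpha> x y * f2 n y \<partial>M\<bar> \<le> (\<integral> y. ?u y \<partial>M)"
          using int2[OF a] W(2)[OF a x] by (intro abs_integral_le_integral_AE integrable_mult_right) auto
        also have "\<dots> = \<bar>b\<bar> * (\<integral> y. K \<alpha> x y * indicator {y. 1 \<le> \<delta> x y} y \<partial>M)" by simp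
        also have "\<dots> \<le> \<bar>b\<bar> * (\<alpha> * W)"
          using W(2)[OF a x] by (intro mult_left_mono) auto
        finally show ?thesis using e by (simp add: kernel_op_def mult_ac)
      qed
      then show "\<exists>W\<ge>0. \<forall>\<alpha>. 0 < \<alpha> \<longrightarrow> \<alpha> < 1 \<longrightarrow> \<bar>kernel_op M (K \<alpha>) (f2 n) x - 0\<bar> \<le> e + \<alpha> * W"
        using W(1) by (intro exI[of _ "\<bar>b\<bar> * W"]) auto
    qed
    then have "((\<lambda>\<alpha>. kernel_op M (K \<alpha>) f x) \<longlongrightarrow> f1 n x + 0) (at_right 0)"
      using elim(1) int1 int2
      by (intro kernel_op_tendsto_add[where f = "f1 n" and g = "f2 n"]) (auto simp: f1_def f2_def algebra_simps)
    then show ?case using xB by (simp add: f1_def)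
  qed
qed

text \<open>Cutting at height 1 makes \<open>\<bar>f\<bar> \<le> \<bar>f\<bar> powr p\<close> on the
  large values, so \<open>f1\<close> is integrable, while \<open>f2\<close> is bounded by 1.\<close>

lemma AE_tendsto_Lp:
  assumes dense: "continuous_dense_L1 M \<delta>" and f: "in_Lp M p f" and p: "1 \<le> p"
  shows "AE x in M. ((\<lambda>\<alpha>. kernel_op M (K \<alpha>) f x) \<longlongrightarrow> f x) (at_right 0)"
proof -
  have [measurable]: "f \<in> borel_measurable M" and fp: "integrable M (\<lambda>x. \<bar>f x\<bar> powr p)"
    using f by (auto simp: in_Lp_def)
  define f1 where "f1 y = (if 1 < \<bar>f y\<bar> then f y else 0)" for y
  define f2 where "f2 y = (if 1 < \<bar>f y\<bar> then 0 else f y)" for y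
  have f1m [measurable]: "f1 \<in> borel_measurable M" and f2m [measurable]: "f2 \<in> borel_measurable M"
    unfolding f1_def[abs_def] f2_def[abs_def] by measurable
  have "integrable M f1"
  proof (rule Bochner_Integration.integrable_bound[OF fp])
    have "\<bar>f1 y\<bar> \<le> \<bar>f y\<bar> powr p" for y
      using powr_mono[of 1 p "\<bar>f y\<bar>"] p by (auto simp: f1_def)
    then show "AE y in M. norm (f1 y) \<le> norm (\<bar>f y\<bar> powr p)" by simp
  qed measurable
  note AE_tendsto_integrable[OF dense this] hlabs_finite_AE[OF this]
  moreover have b2: "AE y in M. \<bar>f2 y\<bar> \<le> 1"
    by (auto simp: f2_def)
  then have "AE x in M. ((\<lambda>\<alpha>. kernel_op M (K \<alpha>) f2 x) \<longlongrightarrow> f2 x) (at_right 0)"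
    by (rule AE_tendsto_bounded[OF dense f2m])
  ultimately show ?thesis
    using AE_space
  proof eventually_elim
    case (elim x)
    then have x: "x \<in> space M" by blast
    have "((\<lambda>\<alpha>. kernel_op M (K \<alpha>) f x) \<longlongrightarrow> f1 x + f2 x) (at_right 0)"
      using elim K_mult_integrable[OF _ _ x f1m] K_mult_bounded(1)[OF _ _ x f2m b2]
      by (intro kernel_op_tendsto_add[where f = f1 and g = f2]) (auto simp: f1_def f2_def)
    then show ?case by (auto simp: f1_def f2_def split: if_splits)
  qed
qed

end

section \<open>From the stated hypotheses to the conclusions\<close>

text \<open>Passing to \<open>max 1 \<tau>\<close> can only weaken the quasi-triangle inequality and
  provides \<open>1 \<le> \<tau>\<close> directly, without deducing it from the existence of two
  distinct points.\<close>

lemma approximate_identity_intro: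
  assumes N: "in_class_N M \<delta> \<tau> c1 c2"
    and s: "s > 0"
    and markov: "\<And>\<alpha>. 0 < \<alpha> \<Longrightarrow> \<alpha> < 1 \<Longrightarrow> symmetric_markov_kernel M (K \<alpha>)"
    and H: "H \<ge> 1" and \<gamma>: "0 < \<gamma>" "\<gamma> \<le> (c1 / (2 * c2))\<^sup>2"
    and Ha: "\<And>\<alpha>. 0 < \<alpha> \<Longrightarrow> \<alpha> < 1 \<Longrightarrow> class_Ha M \<delta> \<gamma> H (K \<alpha>)"
    and R: "R > 0"
    and S: "\<And>\<alpha>. 0 < \<alpha> \<Longrightarrow> \<alpha> < 1 \<Longrightarrow> class_S M \<delta> s \<alpha> R (K \<alpha>)"
  shows "approximate_identity M \<delta> (max 1 \<tau>) c1 c2 \<gamma> H s R K"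
proof
  have qd: "quasi_distance (space M) \<delta> \<tau>" using N by (simp add: in_class_N_def)
  fix x y z assume x: "x \<in> space M" and y: "y \<in> space M"
  show d0: "0 \<le> \<delta> x y" and "\<delta> x y = \<delta> y x" and "\<delta> x y = 0 \<longleftrightarrow> x = y"
    using qd x y by (auto simp: quasi_distance_def)
  assume z: "z \<in> space M"
  have "\<delta> x z \<le> \<tau> * (\<delta> x y + \<delta> y z)"
    using qd x y z by (auto simp: quasi_distance_def)
  also have "\<dots> \<le> max 1 \<tau> * (\<delta> x y + \<delta> y z)"
    using qd x y z by (intro mult_right_mono) (auto simp: quasi_distance_def)
  finally show "\<delta> x z \<le> max 1 \<tau> * (\<delta> x y + \<delta> y z)" .
qed (use assms in \<open>auto simp: in_class_N_def\<close>)

theorem theorem4p5: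
  fixes M :: "'a measure" and \<delta> :: "'a \<Rightarrow> 'a \<Rightarrow> real"
    and \<tau> c1 c2 s \<gamma> H R :: real and K :: "real \<Rightarrow> 'a \<Rightarrow> 'a \<Rightarrow> real"
  assumes N: "in_class_N M \<delta> \<tau> c1 c2"
    and dense: "continuous_dense_L1 M \<delta>"
    and s: "s > 0"
    and markov: "\<And>\<alpha>. 0 < \<alpha> \<Longrightarrow> \<alpha> < 1 \<Longrightarrow> symmetric_markov_kernel M (K \<alpha>)"
    and H: "H \<ge> 1" and \<gamma>: "0 < \<gamma>" "\<gamma> \<le> (c1 / (2 * c2))\<^sup>2"
    and Ha: "\<And>\<alpha>. 0 < \<alpha> \<Longrightarrow> \<alpha> < 1 \<Longrightarrow> class_Ha M \<delta> \<gamma> H (K \<alpha>)"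
    and R: "R > 0"
    and S: "\<And>\<alpha>. 0 < \<alpha> \<Longrightarrow> \<alpha> < 1 \<Longrightarrow> class_S M \<delta> s \<alpha> R (K \<alpha>)"
  shows
    \<comment> \<open>(i) concentration, uniformly in x\<close>
    "(\<forall>t>0. \<forall>\<epsilon>>0. \<exists>\<alpha>0>0. \<forall>\<alpha>. 0 < \<alpha> \<and> \<alpha> < \<alpha>0 \<and> \<alpha> < 1 \<longrightarrow>
        (\<forall>x\<in>space M. (\<integral>\<^sup>+ y. ennreal (K \<alpha> x y) * indicator {y. \<delta> x y \<ge> t} y \<partial>M) < ennreal \<epsilon>))
   \<and>
    \<comment> \<open>(ii) weak type (1,1), stated with outer measure\<close>
    (\<exists>C. \<forall>f. f \<in> borel_measurable M \<and> integrable M f \<longrightarrow>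
        (\<forall>t>0. \<exists>A\<in>sets M. {x \<in> space M. maximal_op M K f x > ennreal t} \<subseteq> A \<and>
             emeasure M A \<le> ennreal (C / t) * (\<integral>\<^sup>+ x. ennreal \<bar>f x\<bar> \<partial>M)))
   \<and>
    \<comment> \<open>(ii) strong type (p,p), 1 < p < infinity\<close>
    (\<forall>p>1. \<exists>C. \<forall>f. in_Lp M p f \<longrightarrow>
        (\<exists>g. g \<in> borel_measurable M \<and> (AE x in M. maximal_op M K f x \<le> ennreal (g x)) \<and>
             in_Lp M p g \<and>
             (\<integral> x. \<bar>g x\<bar> powr p \<partial>M) \<le> C powr p * (\<integral> x. \<bar>f x\<bar> powr p \<partial>M)))
   \<and>
    \<comment> \<open>(ii) boundedness on L^infinity\<close>
    (\<exists>C. \<forall>f B. in_Linf M f \<and> (AE x in M. \<bar>f x\<bar> \<le> B) \<longrightarrow>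
        (AE x in M. maximal_op M K f x \<le> ennreal (C * B)))
   \<and>
    \<comment> \<open>(iii) a.e. convergence, 1 <= p < infinity and p = infinity\<close>
    (\<forall>p\<ge>1. \<forall>f. in_Lp M p f \<longrightarrow>
        (AE x in M. ((\<lambda>\<alpha>. kernel_op M (K \<alpha>) f x) \<longlongrightarrow> f x) (at_right 0)))
   \<and>
    (\<forall>f. in_Linf M f \<longrightarrow>
        (AE x in M. ((\<lambda>\<alpha>. kernel_op M (K \<alpha>) f x) \<longlongrightarrow> f x) (at_right 0)))"
proof -
  interpret approximate_identity M \<delta> "max 1 \<tau>" c1 c2 \<gamma> H s R K
    using N s markov H \<gamma> Ha R S by (rule approximate_identity_intro)
  have "\<exists>C. \<forall>f b. in_Linf M f \<and> (AE x in M. \<bar>f x\<bar> \<le> b) \<longrightarrow>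
      (AE x in M. maximal_op M K f x \<le> ennreal (C * b))"
    \<comment> \<open>On bounded functions the constant is 1, since each kernel averages with total
      mass one.\<close>
    using maximal_op_bounded unfolding in_Linf_def by (intro exI[of _ 1]) simp
  moreover have "\<forall>f. in_Linf M f \<longrightarrow>
      (AE x in M. ((\<lambda>\<alpha>. kernel_op M (K \<alpha>) f x) \<longlongrightarrow> f x) (at_right 0))"
    using AE_tendsto_bounded[OF dense] unfolding in_Linf_def by blast
  moreover have "\<forall>p\<ge>1. \<forall>f. in_Lp M p f \<longrightarrow>
      (AE x in M. ((\<lambda>\<alpha>. kernel_op M (K \<alpha>) f x) \<longlongrightarrow> f x) (at_right 0))"
    using AE_tendsto_Lp[OF dense] by blast
  ultimately show ?thesis
    using maximal_op_weak_type
    by (intro conjI) (use concentration maximal_op_strong_type in \<open>assumption | simp\<close>)+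
qed

end
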